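(* Let $X\subseteq\omega$ and let $G$ be an $X$-computable group. Let $Sym_{\mathbf{0}}(\omega)$ be the group of computable permutations of $\omega$, and let $H:Sym_{\mathbf{0}}(\omega)\to G$ be an injective group homomorphism (of arbitrary complexity). Suppose that for every permutation $p\in Sym_{\mathbf{0}}(\omega)$ that is $1_{\inf}2_{\inf}$ on $\omega$, the element $H(p)$ is not conjugate in $G$ to $H(q)$ for any $q\in Sym_{\mathbf{0}}(\omega)$ that is $1_{\inf}2_{\mathrm{fin}}$ on $\omega$. Then $\mathbf{0}''\leq\deg(X)$.
   Context: A group $G$ is $X$-computable if its domain is a subset of $\omega$ and its domain and group operation are computable relative to $X$. A permutation of $\omega$ is $1_{\inf}2_{\inf}$ if it is a product of infinitely many $1$-cycles and infinitely many $2$-cycles (and has no other cycles); it is $1_{\inf}2_{\mathrm{fin}}$ if it is a product of infinitely many $1$-cycles and finitely many $2$-cycles (and has no other cycles). $\mathbf{0}''$ is the Turing degree of the second jump of $\emptyset$. *)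

theory Defs
  imports Complex_Main "HOL-Library.Nat_Bijection" "HOL-Combinatorics.Orbits" "HOL-Algebra.Group"
begin

section \<open>Partial recursive functions relative to an oracle\<close>

text \<open>
  Programs for the partial functions \<open>\<nat> \<rightharpoonup> \<nat>\<close> that are recursive in an oracle.
  Functions of several arguments are unary functions of Cantor pairs \<^const>\<open>prod_encode\<close>:
  the class is generated from zero, successor, the two unpairing functions and the characteristic
  function of the oracle by pairing, composition, primitive recursion and unbounded minimisation.
\<close>

datatype code =
    CZero | CSucc | CFst | CSnd | COracle
  | CPair code code | CComp code code | CPrec code code | CMin code

text \<open>
  \<open>CPrec c d\<close> denotes \<open>h\<close> with \<open>h (a, 0) = c a\<close> and \<open>h (a, k + 1) = d (a, k, h (a, k))\<close>.
  \<open>CMin c\<close> maps \<open>x\<close> to the least \<open>n\<close> with \<open>c (x, n) = 0\<close>, provided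
  that \<open>c (x, m)\<close> is defined (and nonzero) for all \<open>m < n\<close>.
\<close>

primrec phi :: "nat set \<Rightarrow> code \<Rightarrow> nat \<Rightarrow> nat option" where
  "phi A CZero = (\<lambda>x. Some 0)"
| "phi A CSucc = (\<lambda>x. Some (Suc x))"
| "phi A CFst = (\<lambda>x. Some (fst (prod_decode x)))"
| "phi A CSnd = (\<lambda>x. Some (snd (prod_decode x)))"
| "phi A COracle = (\<lambda>x. Some (if x \<in> A then 1 else 0))"
| "phi A (CPair c d) = (\<lambda>x. Option.bind (phi A c x) (\<lambda>y.
     Option.bind (phi A d x) (\<lambda>z. Some (prod_encode (y, z)))))"
| "phi A (CComp c d) = (\<lambda>x. Option.bind (phi A d x) (phi A c))"
| "phi A (CPrec c d) = (\<lambda>x. case prod_decode x of (a, n) \<Rightarrow>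
     rec_nat (phi A c a)
       (\<lambda>k r. Option.bind r (\<lambda>y. phi A d (prod_encode (a, prod_encode (k, y))))) n)"
| "phi A (CMin c) = (\<lambda>x.
     if \<exists>n. phi A c (prod_encode (x, n)) = Some 0 \<and>
            (\<forall>m<n. phi A c (prod_encode (x, m)) \<noteq> None)
     then Some (LEAST n. phi A c (prod_encode (x, n)) = Some 0)
     else None)"

definition computable_in :: "nat set \<Rightarrow> (nat \<Rightarrow> nat) \<Rightarrow> bool" where
  "computable_in A f \<longleftrightarrow> (\<exists>c. \<forall>x. phi A c x = Some (f x))"

abbreviation computable :: "(nat \<Rightarrow> nat) \<Rightarrow> bool" where
  "computable \<equiv> computable_in {}"

definition set_computable_in :: "nat set \<Rightarrow> nat set \<Rightarrow> bool" where
  "set_computable_in A B \<longleftrightarrow> computable_in A (\<lambda>x. if x \<in> B then 1 else 0)"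


section \<open>Turing degrees and the jump\<close>

primrec subst_oracle :: "code \<Rightarrow> code \<Rightarrow> code" where
  "subst_oracle e CZero = CZero"
| "subst_oracle e CSucc = CSucc"
| "subst_oracle e CFst = CFst"
| "subst_oracle e CSnd = CSnd"
| "subst_oracle e COracle = e"
| "subst_oracle e (CPair c d) = CPair (subst_oracle e c) (subst_oracle e d)"
| "subst_oracle e (CComp c d) = CComp (subst_oracle e c) (subst_oracle e d)"
| "subst_oracle e (CPrec c d) = CPrec (subst_oracle e c) (subst_oracle e d)"
| "subst_oracle e (CMin c) = CMin (subst_oracle e c)"

lemma phi_subst_oracle:
  assumes "\<And>x. phi A e x = Some (if x \<in> B then 1 else 0)"
  shows "phi A (subst_oracle e c) = phi B c"
  by (induction c) (use assms in auto)

lemma set_computable_in_refl: "set_computable_in A A"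
  unfolding set_computable_in_def computable_in_def by (rule exI[of _ COracle]) simp

lemma set_computable_in_trans:
  assumes "set_computable_in A B" "set_computable_in B C"
  shows "set_computable_in A C"
proof -
  obtain e where e: "\<And>x. phi A e x = Some (if x \<in> B then 1 else 0)"
    using assms(1) unfolding set_computable_in_def computable_in_def by blast
  obtain c where "\<And>x. phi B c x = Some (if x \<in> C then 1 else 0)"
    using assms(2) unfolding set_computable_in_def computable_in_def by blast
  then have "phi A (subst_oracle e c) x = Some (if x \<in> C then 1 else 0)" for x
    using phi_subst_oracle[OF e, of c] by simp
  then show ?thesis
    unfolding set_computable_in_def computable_in_def by blast
qed

definition turing_equiv :: "nat set \<Rightarrow> nat set \<Rightarrow> bool" where
  "turing_equiv A B \<longleftrightarrow> set_computable_in A B \<and> set_computable_in B A"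

quotient_type turing_degree = "nat set" / turing_equiv
proof (rule equivpI)
  show "reflp turing_equiv"
    by (auto simp: reflp_def turing_equiv_def set_computable_in_refl)
  show "symp turing_equiv"
    by (auto simp: symp_def turing_equiv_def)
  show "transp turing_equiv"
    by (auto simp: transp_def turing_equiv_def intro: set_computable_in_trans)
qed

lift_definition deg :: "nat set \<Rightarrow> turing_degree" is "\<lambda>A. A" .

instantiation turing_degree :: order
begin

lift_definition less_eq_turing_degree :: "turing_degree \<Rightarrow> turing_degree \<Rightarrow> bool"
  is "\<lambda>A B. set_computable_in B A"
  unfolding turing_equiv_def by (meson set_computable_in_trans)

definition less_turing_degree :: "turing_degree \<Rightarrow> turing_degree \<Rightarrow> bool" where
  "less_turing_degree a b \<longleftrightarrow> a \<le> b \<and> \<not> b \<le> a"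

instance
proof
  fix a b c :: turing_degree
  show "a < b \<longleftrightarrow> a \<le> b \<and> \<not> b \<le> a"
    by (rule less_turing_degree_def)
  show "a \<le> a"
    by transfer (rule set_computable_in_refl)
  show "a \<le> c" if "a \<le> b" "b \<le> c"
    using that by transfer (blast intro: set_computable_in_trans)
  show "a = b" if "a \<le> b" "b \<le> a"
    using that by transfer (simp add: turing_equiv_def)
qed

end

lemma deg_le_iff: "deg A \<le> deg B \<longleftrightarrow> set_computable_in B A"
  by transfer simp

text \<open>
  An effective numbering of the programs. It is not surjective; numbers outside its range index
  the nowhere defined function, so they do not belong to any jump.
\<close>

primrec code_num :: "code \<Rightarrow> nat" where
  "code_num CZero = prod_encode (0, 0)"
| "code_num CSucc = prod_encode (1, 0)"
| "code_num CFst = prod_encode (2, 0)"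
| "code_num CSnd = prod_encode (3, 0)"
| "code_num COracle = prod_encode (4, 0)"
| "code_num (CPair c d) = prod_encode (5, prod_encode (code_num c, code_num d))"
| "code_num (CComp c d) = prod_encode (6, prod_encode (code_num c, code_num d))"
| "code_num (CPrec c d) = prod_encode (7, prod_encode (code_num c, code_num d))"
| "code_num (CMin c) = prod_encode (8, code_num c)"

lemma inj_code_num: "inj code_num"
proof (rule injI)
  show "c = d" if "code_num c = code_num d" for c d
    using that
  proof (induction c arbitrary: d)
  qed (case_tac d; auto simp: prod_encode_eq)+
qed

definition jump :: "nat set \<Rightarrow> nat set" where
  "jump A = {e. \<exists>c. code_num c = e \<and> phi A c e \<noteq> None}"


section \<open>Computable groups and computable permutations\<close>

text \<open>
  The multiplication of a HOL-Algebra group is a total function whose values off the carrier are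
  irrelevant, so a program for it is only required to be correct on the carrier.
\<close>

definition computable_group :: "nat set \<Rightarrow> (nat, 'b) monoid_scheme \<Rightarrow> bool" where
  "computable_group X G \<longleftrightarrow> group G \<and> set_computable_in X (carrier G) \<and>
     (\<exists>c. \<forall>a\<in>carrier G. \<forall>b\<in>carrier G. phi X c (prod_encode (a, b)) = Some (a \<otimes>\<^bsub>G\<^esub> b))"

definition computable_sym :: "(nat \<Rightarrow> nat) monoid" where
  "computable_sym = \<lparr>carrier = {p. bij p \<and> computable p}, mult = (\<circ>), one = id\<rparr>"

definition conjugate_in :: "('a, 'b) monoid_scheme \<Rightarrow> 'a \<Rightarrow> 'a \<Rightarrow> bool" where
  "conjugate_in G a b \<longleftrightarrow> (\<exists>g\<in>carrier G. b = g \<otimes>\<^bsub>G\<^esub> a \<otimes>\<^bsub>G\<^esub> inv\<^bsub>G\<^esub> g)"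

text \<open>
  Only used for \<open>k > 0\<close>. If \<open>p\<close> is bijective and \<open>x\<close> lies on an infinite cycle, then
  \<^term>\<open>orbit p x\<close> is infinite (the forward orbit) and has \<^const>\<open>card\<close> 0.
\<close>

definition cycles_of_length :: "nat \<Rightarrow> ('a \<Rightarrow> 'a) \<Rightarrow> 'a set set" where
  "cycles_of_length k p = {orbit p x | x. card (orbit p x) = k}"

definition one_inf_two_inf :: "(nat \<Rightarrow> nat) \<Rightarrow> bool" where
  "one_inf_two_inf p \<longleftrightarrow> bij p \<and> (\<forall>x. card (orbit p x) \<in> {1, 2}) \<and>
     infinite (cycles_of_length 1 p) \<and> infinite (cycles_of_length 2 p)"

definition one_inf_two_fin :: "(nat \<Rightarrow> nat) \<Rightarrow> bool" where
  "one_inf_two_fin p \<longleftrightarrow> bij p \<and> (\<forall>x. card (orbit p x) \<in> {1, 2}) \<and>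
     infinite (cycles_of_length 1 p) \<and> finite (cycles_of_length 2 p)"

end

(*
  The set 0'' is {e. R e is finite} for a decidable relation R. The involutions p_e with one
  2-cycle (up to a fixed factor) per element of R e, and their truncations p_{e,n}, are given by words,
  uniformly in e and n, in four computable permutations, so X computes e, n |-> H(p_{e,n}) from the images
  of these four. If R e is finite, then H(p_e) = H(p_{e,n}) for some n, and otherwise this never
  happens, by injectivity. If R e is infinite, then p_e is conjugate to a fixed 1_inf 2_inf involution r by a
  computable permutation, hence H(p_e) is conjugate to H(r) in G, and otherwise this never happens,
  by hypothesis. So X decides 0'' by searching for an n or for a conjugating element.
*)
theory Submission
  imports Defs "HOL-Library.Infinite_Set"
begin

section \<open>Computable functions and decidable predicates\<close>

text \<open>Since \<open>H\<close> has arbitrary complexity, a program for a permutation p gives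
  \<open>X\<close> no access to \<open>H p\<close>. Only finitely many values of \<open>H\<close>
  can be built into a program, and every further value must come from them by multiplication in G.
  This is why a single permutation carries all the sets \<open>R e\<close> and all their truncations
  at once, to be extracted from it by words. Both outcomes must be visible to a search. Equality of
  two computable permutations is a universal statement over their arguments, but an injective
  \<open>H\<close> turns it into equality of two numbers. Conjugacy is an existential statement over
  G. The search for a conjugating element cannot be confined to the range of \<open>H\<close>, which
  need not be decidable from \<open>X\<close>; it is sound because the hypothesis excludes conjugacy
  in all of G.\<close>

definition pr :: "nat \<Rightarrow> nat \<Rightarrow> nat" where "pr a b = prod_encode (a, b)"
definition p1 :: "nat \<Rightarrow> nat" where "p1 n = fst (prod_decode n)"
definition p2 :: "nat \<Rightarrow> nat" where "p2 n = snd (prod_decode n)"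

lemma pr_simps [simp]: "p1 (pr a b) = a" "p2 (pr a b) = b" "pr (p1 n) (p2 n) = n"
  "pr a b = pr c d \<longleftrightarrow> a = c \<and> b = d"
  by (simp_all add: pr_def p1_def p2_def prod_encode_eq)

named_theorems rec_intros

lemma computable_inI: "(\<And>x. phi A c x = Some (f x)) \<Longrightarrow> computable_in A f"
  unfolding computable_in_def by blast

lemma rec_comp: "computable_in A f \<Longrightarrow> computable_in A g \<Longrightarrow> computable_in A (\<lambda>v. f (g v))"
proof -
  assume "computable_in A f" "computable_in A g"
  then obtain c d where "\<And>x. phi A c x = Some (f x)" "\<And>x. phi A d x = Some (g x)"
    unfolding computable_in_def by blast
  then show ?thesis by (intro computable_inI[of A "CComp c d"]) simp
qed


lemma rec_pr [rec_intros]: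
  assumes "computable_in A f" "computable_in A g"
  shows "computable_in A (\<lambda>v. pr (f v) (g v))"
proof -
  from assms obtain c d where "\<And>x. phi A c x = Some (f x)" "\<And>x. phi A d x = Some (g x)"
    unfolding computable_in_def by blast
  then show ?thesis by (intro computable_inI[of A "CPair c d"]) (simp add: pr_def)
qed

lemma rec_id [rec_intros]: "computable_in A (\<lambda>v. v)"
  by (rule computable_inI[of A "CPair CFst CSnd"]) simp

lemma rec_p1 [rec_intros]: "computable_in A f \<Longrightarrow> computable_in A (\<lambda>v. p1 (f v))"
  by (rule rec_comp[of A p1 f]) (auto simp: p1_def intro: computable_inI[of A CFst])

lemma rec_p2 [rec_intros]: "computable_in A f \<Longrightarrow> computable_in A (\<lambda>v. p2 (f v))"
  by (rule rec_comp[of A p2 f]) (auto simp: p2_def intro: computable_inI[of A CSnd])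

lemma rec_Suc [rec_intros]: "computable_in A f \<Longrightarrow> computable_in A (\<lambda>v. Suc (f v))"
  by (rule rec_comp[of A Suc f]) (auto intro: computable_inI[of A CSucc])

lemma rec_const [rec_intros]: "computable_in A (\<lambda>v. k)"
proof (induction k)
  case 0
  show ?case by (rule computable_inI[of A CZero]) simp
qed (rule rec_Suc)

lemma rec_2:
  assumes "computable_in A (\<lambda>w. F (p1 w) (p2 w))" "computable_in A f" "computable_in A g"
  shows "computable_in A (\<lambda>v. F (f v) (g v))"
  using rec_comp[OF assms(1) rec_pr[OF assms(2,3)]] by simp

text \<open>Parameter, counter and accumulator are packed as \<open>CPrec\<close> passes them. The
  whole argument v serves as the parameter, paired with the length \<open>n v\<close>.\<close>

lemma rec_nat_rec [rec_intros]:
  assumes "computable_in A c" "computable_in A (\<lambda>w. d (p1 w) (p1 (p2 w)) (p2 (p2 w)))"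
    and "computable_in A n"
  shows "computable_in A (\<lambda>v. rec_nat (c v) (\<lambda>k y. d v k y) (n v))"
proof -
  from assms obtain cc cd where cc: "\<And>x. phi A cc x = Some (c x)"
    and cd: "\<And>w. phi A cd w = Some (d (p1 w) (p1 (p2 w)) (p2 (p2 w)))"
    unfolding computable_in_def by blast
  have "phi A (CPrec cc cd) (pr a n) = Some (rec_nat (c a) (\<lambda>k y. d a k y) n)" for a n
    by (induction n) (use cd[unfolded p1_def p2_def] in \<open>auto simp: pr_def cc\<close>)
  then have "phi A (CPrec cc cd) x = Some (rec_nat (c (p1 x)) (\<lambda>k y. d (p1 x) k y) (p2 x))" for x
    by (metis pr_simps(3))
  then have "computable_in A (\<lambda>x. rec_nat (c (p1 x)) (\<lambda>k y. d (p1 x) k y) (p2 x))"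
    by (rule computable_inI)
  from rec_comp[OF this rec_pr[OF rec_id assms(3)]] show ?thesis by simp
qed

lemma rec_add [rec_intros]:
  "computable_in A f \<Longrightarrow> computable_in A g \<Longrightarrow> computable_in A (\<lambda>v. f v + g v)"
proof -
  assume "computable_in A f" "computable_in A g"
  then have "computable_in A (\<lambda>v. rec_nat (f v) (\<lambda>_ y. Suc y) (g v))"
    by (intro rec_intros)
  moreover have "rec_nat a (\<lambda>_ y. Suc y) b = a + b" for a b :: nat
    by (induction b) auto
  ultimately show ?thesis by simp
qed

lemma rec_diff [rec_intros]:
  "computable_in A f \<Longrightarrow> computable_in A g \<Longrightarrow> computable_in A (\<lambda>v. f v - g v)"
proof -
  assume fg: "computable_in A f" "computable_in A g"
  have pred: "computable_in A (\<lambda>v. rec_nat 0 (\<lambda>k _. k) v)"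
    by (intro rec_intros)
  have "computable_in A (\<lambda>v. rec_nat (f v) (\<lambda>_ y. rec_nat 0 (\<lambda>k _. k) y) (g v))"
    by (intro rec_intros fg)
  moreover have "rec_nat 0 (\<lambda>k _. k) y = y - 1" for y :: nat
    by (cases y) auto
  moreover have "rec_nat a (\<lambda>_ y. y - 1) b = a - b" for a b :: nat
    by (induction b) auto
  ultimately show ?thesis by simp
qed

section \<open>Decidable predicates, bounded quantifiers, counting and minimisation\<close>

definition decidable_in :: "nat set \<Rightarrow> (nat \<Rightarrow> bool) \<Rightarrow> bool" where
  "decidable_in A P \<longleftrightarrow> computable_in A (\<lambda>v. if P v then 1 else 0)"

lemma decidable_inD: "decidable_in A P \<Longrightarrow> computable_in A (\<lambda>v. if P v then 1 else 0)"
  by (simp add: decidable_in_def)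

lemma dec_comp: "decidable_in A P \<Longrightarrow> computable_in A g \<Longrightarrow> decidable_in A (\<lambda>v. P (g v))"
  unfolding decidable_in_def by (rule rec_comp)

text \<open>A recursion whose length is the truth value selects the branch: \<open>g\<close> is the
  start value, and a single step overwrites it with \<open>f\<close>.\<close>

lemma rec_if [rec_intros]:
  assumes "decidable_in A P" "computable_in A f" "computable_in A g"
  shows "computable_in A (\<lambda>v. if P v then f v else g v)"
proof -
  have f: "computable_in A (\<lambda>w. f (p1 w))"
    by (rule rec_comp[OF assms(2)]) (intro rec_intros)
  have "computable_in A (\<lambda>v. rec_nat (g v) (\<lambda>_ _. f v) (if P v then 1 else 0))"
    by (intro rec_nat_rec assms f decidable_inD)
  moreover have "rec_nat (g v) (\<lambda>_ _. f v) (if P v then 1 else 0) = (if P v then f v else g v)" for v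
    by simp
  ultimately show ?thesis by simp
qed

lemma decidable_in_eq_0:
  assumes "computable_in A f" "\<And>v. P v \<longleftrightarrow> f v = 0"
  shows "decidable_in A P"
proof -
  have "computable_in A (\<lambda>v. 1 - f v)"
    by (intro rec_intros assms)
  moreover have "1 - f v = (if P v then 1 else 0)" for v
    using assms(2) by simp
  ultimately show ?thesis unfolding decidable_in_def by simp
qed

lemma dec_const [rec_intros]: "decidable_in A (\<lambda>v. P)"
  unfolding decidable_in_def by (rule rec_const)

lemma dec_le [rec_intros]:
  "computable_in A f \<Longrightarrow> computable_in A g \<Longrightarrow> decidable_in A (\<lambda>v. f v \<le> g v)"
  by (rule decidable_in_eq_0[of _ "\<lambda>v. f v - g v"]) (intro rec_intros | auto)+

lemma dec_less [rec_intros]: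
  "computable_in A f \<Longrightarrow> computable_in A g \<Longrightarrow> decidable_in A (\<lambda>v. f v < g v)"
  by (rule decidable_in_eq_0[of _ "\<lambda>v. Suc (f v) - g v"]) (intro rec_intros | auto)+

lemma dec_eq [rec_intros]:
  "computable_in A f \<Longrightarrow> computable_in A g \<Longrightarrow> decidable_in A (\<lambda>v. f v = g v)"
  by (rule decidable_in_eq_0[of _ "\<lambda>v. (f v - g v) + (g v - f v)"]) (intro rec_intros | auto)+

lemma dec_not [rec_intros]: "decidable_in A P \<Longrightarrow> decidable_in A (\<lambda>v. \<not> P v)"
  by (rule decidable_in_eq_0[of _ "\<lambda>v. if P v then 1 else 0"]) (auto intro: decidable_inD)

lemma dec_conj [rec_intros]:
  assumes "decidable_in A P" "decidable_in A Q"
  shows "decidable_in A (\<lambda>v. P v \<and> Q v)"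
proof -
  have "computable_in A (\<lambda>v. if P v then if Q v then 1 else 0 else 0)"
    by (intro rec_intros assms)
  moreover have "(if P v then if Q v then 1 else 0 else 0) = (if P v \<and> Q v then 1 else (0::nat))" for v
    by simp
  ultimately show ?thesis unfolding decidable_in_def by simp
qed

lemma dec_disj [rec_intros]:
  assumes "decidable_in A P" "decidable_in A Q"
  shows "decidable_in A (\<lambda>v. P v \<or> Q v)"
  using dec_not[OF dec_conj[OF assms[THEN dec_not]]] by simp

lemma dec_imp [rec_intros]:
  assumes "decidable_in A P" "decidable_in A Q"
  shows "decidable_in A (\<lambda>v. P v \<longrightarrow> Q v)"
  using dec_disj[OF dec_not[OF assms(1)] assms(2)] by simp

lemma dec_ex [rec_intros]:
  assumes "decidable_in A (\<lambda>w. P (p1 w) (p2 w))" "computable_in A b"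
  shows "decidable_in A (\<lambda>v. \<exists>i<b v. P v i)"
proof -
  have "decidable_in A (\<lambda>w. P (p1 w) (p1 (p2 w)))"
    using dec_comp[OF assms(1), of "\<lambda>w. pr (p1 w) (p1 (p2 w))"]
    by (simp add: rec_pr rec_p1 rec_p2 rec_id)
  then have "computable_in A (\<lambda>v. rec_nat 0 (\<lambda>i y. if P v i then 1 else y) (b v))"
    by (intro rec_intros assms)
  moreover have "rec_nat 0 (\<lambda>i y. if P v i then 1 else y) n = (if \<exists>i<n. P v i then 1 else (0::nat))" for v n
    by (induction n) (auto simp: less_Suc_eq)
  ultimately show ?thesis unfolding decidable_in_def by simp
qed

lemma dec_all [rec_intros]:
  assumes "decidable_in A (\<lambda>w. P (p1 w) (p2 w))" "computable_in A b"
  shows "decidable_in A (\<lambda>v. \<forall>i<b v. P v i)"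
  using dec_not[OF dec_ex[OF dec_not[OF assms(1)] assms(2)]] by simp

lemma rec_card [rec_intros]:
  assumes "decidable_in A (\<lambda>w. P (p1 w) (p2 w))" "computable_in A b"
  shows "computable_in A (\<lambda>v. card {i. i < b v \<and> P v i})"
proof -
  have "decidable_in A (\<lambda>w. P (p1 w) (p1 (p2 w)))"
    using dec_comp[OF assms(1), of "\<lambda>w. pr (p1 w) (p1 (p2 w))"]
    by (simp add: rec_pr rec_p1 rec_p2 rec_id)
  then have "computable_in A (\<lambda>v. rec_nat 0 (\<lambda>i y. if P v i then Suc y else y) (b v))"
    by (intro rec_intros assms)
  moreover have "rec_nat 0 (\<lambda>i y. if P v i then Suc y else y) n = card {i. i < n \<and> P v i}" for v n
  proof (induction n)
    case (Suc n)
    have "{i. i < Suc n \<and> P v i} = (if P v n then insert n {i. i < n \<and> P v i} else {i. i < n \<and> P v i})"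
      by (auto simp: less_Suc_eq)
    with Suc show ?case by simp
  qed simp
  ultimately show ?thesis by simp
qed

lemma rec_Least:
  assumes "decidable_in A (\<lambda>w. P (p1 w) (p2 w))" "\<And>v. \<exists>n. P v n"
  shows "computable_in A (\<lambda>v. LEAST n. P v n)"
proof -
  \<comment> \<open>\<open>CMin\<close> searches for a zero, hence the reversed truth
    values.\<close>
  have "computable_in A (\<lambda>w. if P (p1 w) (p2 w) then 0 else 1)"
    by (intro rec_intros assms)
  then obtain c where c: "\<And>w. phi A c w = Some (if P (p1 w) (p2 w) then 0 else 1)"
    unfolding computable_in_def by blast
  have "phi A c (prod_encode (v, n)) = Some (if P v n then 0 else 1)" for v n
    using c[of "pr v n"] by (simp add: pr_def p1_def p2_def)
  then have "phi A (CMin c) v = Some (LEAST n. P v n)" for v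
    using assms(2)[of v] by simp
  then show ?thesis by (rule computable_inI)
qed

lemma dec_2:
  assumes "decidable_in A (\<lambda>w. P (p1 w) (p2 w))" "computable_in A f" "computable_in A g"
  shows "decidable_in A (\<lambda>v. P (f v) (g v))"
  using dec_comp[OF assms(1) rec_pr[OF assms(2,3)]] by simp

section \<open>Computations as derivations\<close>

lemma phi_pr [simp]:
  "phi A CFst x = Some (p1 x)" "phi A CSnd x = Some (p2 x)"
  "phi A (CPair c d) x = Option.bind (phi A c x) (\<lambda>y. Option.bind (phi A d x) (\<lambda>z. Some (pr y z)))"
  "phi A (CPrec c d) (pr a 0) = phi A c a"
  "phi A (CPrec c d) (pr a (Suc k)) =
     Option.bind (phi A (CPrec c d) (pr a k)) (\<lambda>y. phi A d (pr a (pr k y)))"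
  by (simp_all add: p1_def p2_def pr_def)

declare phi.simps(3,4,6,8,9) [simp del]

text \<open>Trades the \<open>LEAST\<close> of the semantics for conditions on single values, which
  is what one step of a derivation can check.\<close>

lemma phi_CMin_eq_Some:
  "phi A (CMin c) x = Some n \<longleftrightarrow>
     phi A c (pr x n) = Some 0 \<and> (\<forall>m<n. \<exists>z. phi A c (pr x m) = Some z \<and> 0 < z)"
  (is "_ \<longleftrightarrow> ?R n")
proof -
  have uniq: "(LEAST n. phi A c (pr x n) = Some 0) = n" if "?R n" for n
  proof (rule Least_equality)
    show "n \<le> m" if "phi A c (pr x m) = Some 0" for m
      using \<open>?R n\<close> that by (metis less_irrefl not_le option.inject)
  qed (use that in simp)
  have min: "?R (LEAST n. phi A c (pr x n) = Some 0)"
    if "phi A c (pr x k) = Some 0" "\<forall>m<k. phi A c (pr x m) \<noteq> None" for k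
  proof (intro conjI allI impI)
    let ?l = "LEAST n. phi A c (pr x n) = Some 0"
    show "phi A c (pr x ?l) = Some 0" by (rule LeastI[of _ k]) (rule that)
    fix m assume m: "m < ?l"
    then have "phi A c (pr x m) \<noteq> Some 0" by (rule not_less_Least)
    moreover have "?l \<le> k" by (rule Least_le) (rule that)
    ultimately show "\<exists>z. phi A c (pr x m) = Some z \<and> 0 < z"
      using m that(2) by (metis bot_nat_0.not_eq_extremum less_le_trans not_None_eq)
  qed
  have eq: "phi A (CMin c) x =
      (if \<exists>n. phi A c (pr x n) = Some 0 \<and> (\<forall>m<n. phi A c (pr x m) \<noteq> None)
       then Some (LEAST n. phi A c (pr x n) = Some 0) else None)"
    by (simp add: phi.simps(9) pr_def)
  show ?thesis
  proof
    assume "phi A (CMin c) x = Some n"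
    then obtain k where "phi A c (pr x k) = Some 0" "\<forall>m<k. phi A c (pr x m) \<noteq> None"
      "n = (LEAST n. phi A c (pr x n) = Some 0)"
      unfolding eq by (auto split: if_splits)
    then show "?R n" using min by blast
  next
    assume R: "?R n"
    then have "\<exists>n. phi A c (pr x n) = Some 0 \<and> (\<forall>m<n. phi A c (pr x m) \<noteq> None)"
      by (metis not_None_eq)
    then show "phi A (CMin c) x = Some n"
      unfolding eq using uniq[OF R] by simp
  qed
qed

lemma code_num_pr [simp]:
  "code_num CZero = pr 0 0" "code_num CSucc = pr 1 0" "code_num CFst = pr 2 0"
  "code_num CSnd = pr 3 0" "code_num COracle = pr 4 0"
  "code_num (CPair c d) = pr 5 (pr (code_num c) (code_num d))"
  "code_num (CComp c d) = pr 6 (pr (code_num c) (code_num d))"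
  "code_num (CPrec c d) = pr 7 (pr (code_num c) (code_num d))"
  "code_num (CMin c) = pr 8 (code_num c)"
  by (simp_all add: pr_def)

declare code_num.simps [simp del]

text \<open>
  A computation is certified by a sequence of facts, each following from earlier ones. There are two kinds
  of facts, tagged by the first component: \<open>run n x y\<close> says that the program with number \<open>n\<close>
  maps \<open>x\<close> to \<open>y\<close>, and \<open>isc n\<close> says that \<open>n\<close> is the number of a program. The latter is
  needed because the recursion step of a \<^const>\<open>CPrec\<close> is not run at argument 0. Oracle answers are
  left open (any bit will do) and are constrained separately by \<open>query_ok\<close>, which keeps derivations
  decidable.
\<close>

definition run :: "nat \<Rightarrow> nat \<Rightarrow> nat \<Rightarrow> nat" where
  "run n x y = pr 1 (pr n (pr x y))"

definition isc :: "nat \<Rightarrow> nat" where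
  "isc n = pr 0 n"

lemma run_isc_simps [simp]: "p1 (run n x y) = 1" "p1 (isc n) = 0"
  "p1 (p2 (run n x y)) = n" "p1 (p2 (p2 (run n x y))) = x" "p2 (p2 (p2 (run n x y))) = y"
  "p2 (isc n) = n" "run n x y = run n' x' y' \<longleftrightarrow> n = n' \<and> x = x' \<and> y = y'"
  "isc n = isc n' \<longleftrightarrow> n = n'" "run n x y \<noteq> isc m"  "isc m \<noteq> run n x y"
  by (simp_all add: run_def isc_def)

definition code_step :: "nat set \<Rightarrow> nat \<Rightarrow> bool" where
  "code_step S n \<longleftrightarrow> p1 n < 5 \<and> p2 n = 0 \<or>
     5 \<le> p1 n \<and> p1 n < 8 \<and> isc (p1 (p2 n)) \<in> S \<and> isc (p2 (p2 n)) \<in> S \<or>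
     p1 n = 8 \<and> isc (p2 n) \<in> S"

definition run_step :: "nat set \<Rightarrow> nat \<Rightarrow> nat \<Rightarrow> nat \<Rightarrow> bool" where
  "run_step S n x y \<longleftrightarrow>
     n = pr 0 0 \<and> y = 0 \<or> n = pr 1 0 \<and> y = Suc x \<or> n = pr 2 0 \<and> y = p1 x \<or>
     n = pr 3 0 \<and> y = p2 x \<or> n = pr 4 0 \<and> y \<le> 1 \<or>
     p1 n = 5 \<and> run (p1 (p2 n)) x (p1 y) \<in> S \<and> run (p2 (p2 n)) x (p2 y) \<in> S \<or>
     p1 n = 6 \<and> (\<exists>z. run (p2 (p2 n)) x z \<in> S \<and> run (p1 (p2 n)) z y \<in> S) \<or>
     p1 n = 7 \<and> isc (p2 (p2 n)) \<in> S \<and> p2 x = 0 \<and> run (p1 (p2 n)) (p1 x) y \<in> S \<or>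
     p1 n = 7 \<and> p2 x \<noteq> 0 \<and> (\<exists>z. run n (pr (p1 x) (p2 x - 1)) z \<in> S \<and>
       run (p2 (p2 n)) (pr (p1 x) (pr (p2 x - 1) z)) y \<in> S) \<or>
     p1 n = 8 \<and> run (p2 n) (pr x y) 0 \<in> S \<and> (\<forall>j<y. \<exists>z. run (p2 n) (pr x j) z \<in> S \<and> 0 < z)"

definition step :: "nat set \<Rightarrow> nat \<Rightarrow> bool" where
  "step S t \<longleftrightarrow> p1 t = 0 \<and> code_step S (p2 t) \<or>
     p1 t = 1 \<and> run_step S (p1 (p2 t)) (p1 (p2 (p2 t))) (p2 (p2 (p2 t)))"

definition query_ok :: "nat set \<Rightarrow> nat \<Rightarrow> bool" where
  "query_ok A t \<longleftrightarrow> (\<forall>x y. t = run (pr 4 0) x y \<longrightarrow> y = (if x \<in> A then 1 else 0))"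

definition derivation :: "nat \<Rightarrow> (nat \<Rightarrow> nat) \<Rightarrow> bool" where
  "derivation n E \<longleftrightarrow> (\<forall>i<n. step (E ` {..<i}) (E i))"

definition derivable :: "nat set \<Rightarrow> nat \<Rightarrow> bool" where
  "derivable A t \<longleftrightarrow>
     (\<exists>n E. derivation n E \<and> (\<forall>i<n. query_ok A (E i)) \<and> t \<in> E ` {..<n})"

text \<open>Earlier facts occur only positively in a step. Hence derivations can be
  concatenated.\<close>

lemma step_mono: "step S t \<Longrightarrow> S \<subseteq> S' \<Longrightarrow> step S' t"
  unfolding step_def run_step_def code_step_def
  by (elim disjE conjE exE) (simp; blast)+

lemma derivation_append:
  assumes "derivation n E" "derivation m F"
  shows "derivation (n + m) (\<lambda>i. if i < n then E i else F (i - n))" (is "derivation _ ?G")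
  unfolding derivation_def
proof (intro allI impI)
  fix i assume i: "i < n + m"
  show "step (?G ` {..<i}) (?G i)"
  proof (cases "i < n")
    case True
    then have "?G ` {..<i} = E ` {..<i}" by auto
    with True assms(1) show ?thesis by (simp add: derivation_def)
  next
    case False
    have "F ` {..<i - n} \<subseteq> ?G ` {..<i}"
    proof
      fix t assume "t \<in> F ` {..<i - n}"
      then obtain j where "j < i - n" "t = F j" by blast
      then have "n + j < i" "t = ?G (n + j)" by auto
      then show "t \<in> ?G ` {..<i}" by blast
    qed
    moreover have "step (F ` {..<i - n}) (F (i - n))"
      using False i assms(2) by (simp add: derivation_def)
    ultimately show ?thesis using False by (auto intro: step_mono)
  qed
qed

lemma image_append:
  "(\<lambda>i. if i < n then E i else F (i - n)) ` {..<n + m} = E ` {..<n} \<union> F ` {..<m}" for n m :: nat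
proof (intro equalityI subsetI)
  fix t assume "t \<in> E ` {..<n} \<union> F ` {..<m}"
  then consider i where "i < n" "t = E i" | i where "i < m" "t = F i" by blast
  then show "t \<in> (\<lambda>i. if i < n then E i else F (i - n)) ` {..<n + m}"
  proof cases
    case 1
    then show ?thesis by (intro image_eqI[of _ _ i]) auto
  next
    case 2
    then show ?thesis by (intro image_eqI[of _ _ "n + i"]) auto
  qed
qed auto

text \<open>A minimisation step with result y rests on y + 1 earlier facts, each known only through
  a derivation of its own; concatenation collects them in one.\<close>

lemma derivable_join:
  assumes "finite S" "\<And>s. s \<in> S \<Longrightarrow> derivable A s"
  shows "\<exists>n E. derivation n E \<and> (\<forall>t\<in>E ` {..<n}. query_ok A t) \<and> S \<subseteq> E ` {..<n}"
  using assms
proof (induction S)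
  case empty
  have "derivation 0 E" for E by (simp add: derivation_def)
  then show ?case by fastforce
next
  case (insert s S)
  then obtain n E where 1: "derivation n E" "\<forall>t\<in>E ` {..<n}. query_ok A t" "S \<subseteq> E ` {..<n}"
    by blast
  from insert.prems obtain m F where 2: "derivation m F" "\<forall>t\<in>F ` {..<m}. query_ok A t" "s \<in> F ` {..<m}"
    unfolding derivable_def by blast
  have "insert s S \<subseteq> E ` {..<n} \<union> F ` {..<m}" "\<forall>t\<in>E ` {..<n} \<union> F ` {..<m}. query_ok A t"
    using 1 2 by auto
  with derivation_append[OF 1(1) 2(1)] show ?case
    by (intro exI[of _ "n + m"] exI[of _ "\<lambda>i. if i < n then E i else F (i - n)"])
       (simp only: image_append simp_thms)
qed

text \<open>Lets \<open>derivable\<close> be used like an inductive predicate: the derivations of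
  the premises are merged and t becomes the last entry.\<close>

lemma derivableI:
  assumes "step S t" "finite S" "\<And>s. s \<in> S \<Longrightarrow> derivable A s" "query_ok A t"
  shows "derivable A t"
proof -
  obtain n E where E: "derivation n E" "\<forall>t\<in>E ` {..<n}. query_ok A t" "S \<subseteq> E ` {..<n}"
    using derivable_join[OF assms(2,3)] by blast
  have "(\<lambda>i. if i < n then E i else t) ` {..<i} = E ` {..<i}" if "i \<le> n" for i
    using that by (intro image_cong) auto
  moreover have "step (E ` {..<n}) t" using step_mono[OF assms(1) E(3)] .
  ultimately have "derivation (Suc n) (\<lambda>i. if i < n then E i else t)"
    using E(1) unfolding derivation_def by (simp add: less_Suc_eq del: if_image_distrib)
  with E assms(4) show ?thesis
    unfolding derivable_def by (intro exI[of _ "Suc n"] exI[of _ "\<lambda>i. if i < n then E i else t"]) auto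
qed

lemma query_ok_isc [simp]: "query_ok A (isc n)"
  by (simp add: query_ok_def)

lemma query_ok_run [simp]: "p1 n \<noteq> 4 \<Longrightarrow> query_ok A (run n x y)"
  by (auto simp: query_ok_def)

lemma derivable_isc: "derivable A (isc (code_num c))"
proof (induction c)
  case (CPair c d)
  show ?case by (rule derivableI[of "{isc (code_num c), isc (code_num d)}"])
    (use CPair in \<open>auto simp: step_def code_step_def\<close>)
next
  case (CComp c d)
  show ?case by (rule derivableI[of "{isc (code_num c), isc (code_num d)}"])
    (use CComp in \<open>auto simp: step_def code_step_def\<close>)
next
  case (CPrec c d)
  show ?case by (rule derivableI[of "{isc (code_num c), isc (code_num d)}"])
    (use CPrec in \<open>auto simp: step_def code_step_def\<close>)
next
  case (CMin c)
  show ?case by (rule derivableI[of "{isc (code_num c)}"])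
    (use CMin in \<open>auto simp: step_def code_step_def\<close>)
qed (rule derivableI[of "{}"]; simp add: step_def code_step_def)+

lemma derivable_run: "phi A c x = Some y \<Longrightarrow> derivable A (run (code_num c) x y)"
proof (induction c arbitrary: x y)
  case (CPair c d)
  then obtain u v where "phi A c x = Some u" "phi A d x = Some v" "y = pr u v"
    by (auto simp: bind_eq_Some_conv)
  with CPair.IH show ?case
    by - (rule derivableI[of "{run (code_num c) x u, run (code_num d) x v}"];
       auto simp: step_def run_step_def)
next
  case (CComp c d)
  then obtain z where "phi A d x = Some z" "phi A c z = Some y"
    by (auto simp: bind_eq_Some_conv)
  with CComp.IH show ?case
    by - (rule derivableI[of "{run (code_num d) x z, run (code_num c) z y}"]; auto simp: step_def run_step_def)
next
  case (CPrec c d)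
  \<comment> \<open>The structural hypotheses speak of c and d only; the runs of
    \<open>CPrec c d\<close> itself at smaller counters need an induction on the counter.\<close>
  have "derivable A (run (code_num (CPrec c d)) (pr a k) y)"
    if "phi A (CPrec c d) (pr a k) = Some y" for a k y
    using that
  proof (induction k arbitrary: y)
    case 0
    with CPrec.IH(1)[of a y] derivable_isc[of A d] show ?case
      by - (rule derivableI[of "{isc (code_num d), run (code_num c) a y}"]; auto simp: step_def run_step_def)
  next
    case (Suc k)
    then obtain z where "phi A (CPrec c d) (pr a k) = Some z" "phi A d (pr a (pr k z)) = Some y"
      by (auto simp: bind_eq_Some_conv)
    with Suc.IH CPrec.IH(2) show ?case
      by - (rule derivableI[of "{run (code_num (CPrec c d)) (pr a k) z, run (code_num d) (pr a (pr k z)) y}"]; auto simp: step_def run_step_def)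
  qed
  from this[of "p1 x" "p2 x" y] CPrec.prems show ?case by simp
next
  case (CMin c)
  then have 0: "phi A c (pr x y) = Some 0"
    and "\<forall>m<y. \<exists>z. phi A c (pr x m) = Some z \<and> 0 < z"
    by (auto simp: phi_CMin_eq_Some)
  \<comment> \<open>Naming one value per smaller argument makes the set of premises explicit and
    finite.\<close>
  then obtain f where f: "\<And>m. m < y \<Longrightarrow> phi A c (pr x m) = Some (f m) \<and> 0 < f m"
    by metis
  show ?case
    using CMin.IH[OF 0] CMin.IH f
    by - (rule derivableI[of "insert (run (code_num c) (pr x y) 0)
          ((\<lambda>m. run (code_num c) (pr x m) (f m)) ` {..<y})"]; auto simp: step_def run_step_def)
next
  case COracle
  then show ?case
    by - (rule derivableI[of "{}"]; auto simp: step_def run_step_def query_ok_def)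
qed (rule derivableI[of "{}"]; simp add: step_def run_step_def)+

section \<open>Soundness of derivations\<close>

definition holds :: "nat set \<Rightarrow> nat \<Rightarrow> bool" where
  "holds A t \<longleftrightarrow> (\<exists>c. t = isc (code_num c)) \<or>
     (\<exists>c x y. t = run (code_num c) x y \<and> phi A c x = Some y)"

lemma holds_isc [simp]: "holds A (isc n) \<longleftrightarrow> (\<exists>c. n = code_num c)"
  by (auto simp: holds_def)

lemma holds_run [simp]: "holds A (run n x y) \<longleftrightarrow> (\<exists>c. n = code_num c \<and> phi A c x = Some y)"
  by (auto simp: holds_def)

lemma holds_code_step:
  assumes "code_step S n" "\<And>s. s \<in> S \<Longrightarrow> holds A s"
  shows "\<exists>c. n = code_num c"
proof -
  obtain k m where n: "n = pr k m" by (metis pr_simps(3))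
  from assms(1) consider "k < 5" "m = 0"
    | "5 \<le> k" "k < 8" "isc (p1 m) \<in> S" "isc (p2 m) \<in> S"
    | "k = 8" "isc m \<in> S"
    unfolding code_step_def n by auto
  then show ?thesis
  proof cases
    case 1
    then have "k = 0 \<or> k = 1 \<or> k = 2 \<or> k = 3 \<or> k = 4" by auto
    with 1 show ?thesis unfolding n by (metis code_num_pr(1-5))
  next
    case 2
    then obtain c d where "p1 m = code_num c" "p2 m = code_num d"
      using assms(2) by (metis holds_isc)
    then have "m = pr (code_num c) (code_num d)" by (metis pr_simps(3))
    moreover have "k = 5 \<or> k = 6 \<or> k = 7" using 2 by auto
    ultimately show ?thesis unfolding n by (metis code_num_pr(6-8))
  next
    case 3
    then show ?thesis using assms(2) unfolding n by (metis code_num_pr(9) holds_isc)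
  qed
qed

lemma code_num_eq_pr: 
  "code_num c = pr 7 m \<Longrightarrow> \<exists>a b. c = CPrec a b \<and> m = pr (code_num a) (code_num b)"
  by (cases c) auto

lemma holds_run_step:
  assumes "run_step S n x y" "\<And>s. s \<in> S \<Longrightarrow> holds A s" "query_ok A (run n x y)"
  shows "\<exists>c. n = code_num c \<and> phi A c x = Some y"
proof -
  obtain k m where n: "n = pr k m" by (metis pr_simps(3))
  obtain a b where x: "x = pr a b" by (metis pr_simps(3))
  from assms(1) consider "n = pr 0 0" "y = 0" | "n = pr 1 0" "y = Suc x" | "n = pr 2 0" "y = p1 x"
    | "n = pr 3 0" "y = p2 x" | "n = pr 4 0"
    | "k = 5" "run (p1 m) x (p1 y) \<in> S" "run (p2 m) x (p2 y) \<in> S"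
    | z where "k = 6" "run (p2 m) x z \<in> S" "run (p1 m) z y \<in> S"
    | "k = 7" "isc (p2 m) \<in> S" "b = 0" "run (p1 m) a y \<in> S"
    | z where "k = 7" "b \<noteq> 0" "run n (pr a (b - 1)) z \<in> S"
       "run (p2 m) (pr a (pr (b - 1) z)) y \<in> S"
    | "k = 8" "run m (pr x y) 0 \<in> S" "\<forall>j<y. \<exists>z. run m (pr x j) z \<in> S \<and> 0 < z"
    unfolding run_step_def n x pr_simps by (elim disjE exE conjE; meson)
  then show ?thesis
  proof cases
    case 1 then show ?thesis by (intro exI[of _ CZero]) simp
  next
    case 2 then show ?thesis by (intro exI[of _ CSucc]) simp
  next
    case 3 then show ?thesis by (intro exI[of _ CFst]) simp
  next
    case 4 then show ?thesis by (intro exI[of _ CSnd]) simp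
  next
    case 5 with assms(3) show ?thesis by (intro exI[of _ COracle]) (simp add: query_ok_def)
  next
    case 6
    then obtain c d where "p1 m = code_num c" "p2 m = code_num d"
      "phi A c x = Some (p1 y)" "phi A d x = Some (p2 y)"
      using assms(2) by (metis holds_run)
    moreover from this have "m = pr (code_num c) (code_num d)" by (metis pr_simps(3))
    ultimately show ?thesis using 6(1) n by (intro exI[of _ "CPair c d"]) simp
  next
    case 7
    then obtain c d where "p1 m = code_num c" "p2 m = code_num d"
      "phi A d x = Some z" "phi A c z = Some y"
      using assms(2) by (metis holds_run)
    moreover from this have "m = pr (code_num c) (code_num d)" by (metis pr_simps(3))
    ultimately show ?thesis using 7(1) n by (intro exI[of _ "CComp c d"]) simp
  next
    case 8
    then obtain c d where "p1 m = code_num c" "p2 m = code_num d" "phi A c a = Some y"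
      using assms(2) by (metis holds_run holds_isc)
    moreover from this have "m = pr (code_num c) (code_num d)" by (metis pr_simps(3))
    ultimately show ?thesis using 8(1,3) n x by (intro exI[of _ "CPrec c d"]) simp
  next
    case 9
    then obtain e d where e: "n = code_num e" "phi A e (pr a (b - 1)) = Some z"
      and d: "p2 m = code_num d" "phi A d (pr a (pr (b - 1) z)) = Some y"
      using assms(2) by (metis holds_run)
    \<comment> \<open>The premise runs n itself at the smaller counter, so n already numbers a
      program; its tag 7 makes that a \<open>CPrec\<close>, and injectivity of
      \<open>code_num\<close> identifies its second part with d.\<close>
    from e 9(1) n obtain c d' where "e = CPrec c d'" "m = pr (code_num c) (code_num d')"
      using code_num_eq_pr by metis
    with d have "e = CPrec c d" using inj_code_num by (simp add: inj_eq)
    moreover obtain b' where "b = Suc b'" using 9(2) by (cases b) auto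
    ultimately show ?thesis using e d x by (intro exI[of _ e]) simp
  next
    case 10
    then obtain c where c: "m = code_num c" "phi A c (pr x y) = Some 0"
      using assms(2) by (metis holds_run)
    have "\<exists>z. phi A c (pr x j) = Some z \<and> 0 < z" if "j < y" for j
      using 10(3) that assms(2) c(1) inj_code_num by (metis holds_run injD)
    with c 10(1) n show ?thesis by (intro exI[of _ "CMin c"]) (simp add: phi_CMin_eq_Some)
  qed
qed

lemma derivation_holds:
  assumes "derivation n E" "\<And>i. i < n \<Longrightarrow> query_ok A (E i)" "i < n"
  shows "holds A (E i)"
  using assms(3)
proof (induction i rule: less_induct)
  case (less i)
  then have S: "holds A s" if "s \<in> E ` {..<i}" for s using that by auto
  have q: "query_ok A (E i)" and "step (E ` {..<i}) (E i)"
    using less.prems assms unfolding derivation_def by auto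
  then consider "p1 (E i) = 0" "code_step (E ` {..<i}) (p2 (E i))"
    | "p1 (E i) = 1" "run_step (E ` {..<i}) (p1 (p2 (E i))) (p1 (p2 (p2 (E i)))) (p2 (p2 (p2 (E i))))"
    unfolding step_def by meson
  then show ?case
  proof cases
    case 1
    then have "E i = isc (p2 (E i))" by (metis isc_def pr_simps(3))
    with holds_code_step[OF 1(2) S] show ?thesis by (metis holds_isc)
  next
    case 2
    then have "E i = run (p1 (p2 (E i))) (p1 (p2 (p2 (E i)))) (p2 (p2 (p2 (E i))))"
      by (metis run_def pr_simps(3))
    with holds_run_step[OF 2(2) S] q show ?thesis by (metis holds_run)
  qed
qed

text \<open>A form of Kleene's normal form: convergence is the existence of a finite object that can
  be checked effectively apart from its oracle answers.\<close>

lemma phi_eq_Some_iff_derivable: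
  "(\<exists>c. n = code_num c \<and> phi A c x = Some y) \<longleftrightarrow> derivable A (run n x y)"
proof
  assume "derivable A (run n x y)"
  then obtain m E where E: "derivation m E" "\<forall>i<m. query_ok A (E i)" "run n x y \<in> E ` {..<m}"
    unfolding derivable_def by blast
  then obtain i where "i < m" "run n x y = E i" by blast
  with derivation_holds[OF E(1), of A i] E(2) have "holds A (run n x y)" by simp
  then show "\<exists>c. n = code_num c \<and> phi A c x = Some y" by simp
qed (auto intro: derivable_run)

lemma mem_jump_iff: "e \<in> jump A \<longleftrightarrow> (\<exists>y. derivable A (run e e y))"
  unfolding jump_def phi_eq_Some_iff_derivable[symmetric] by fastforce

section \<open>The double jump as a finiteness problem\<close>

text \<open>Nested pairs read as a list. Every number codes some sequence, so a search for
  derivations may range over all numbers.\<close>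

definition ent :: "nat \<Rightarrow> nat \<Rightarrow> nat" where
  "ent D i = p1 (rec_nat D (\<lambda>_ y. p2 y) i)"

lemma ex_ent: "\<exists>D. \<forall>i<n. ent D i = E i"
proof (induction n arbitrary: E)
  case (Suc n)
  from Suc[of "\<lambda>i. E (Suc i)"] obtain D where D: "\<forall>i<n. ent D i = E (Suc i)" ..
  have "rec_nat (pr a D) (\<lambda>_ y. p2 y) (Suc i) = rec_nat D (\<lambda>_ y. p2 y) i" for a i
    by (induction i) simp_all
  then have "ent (pr (E 0) D) (Suc i) = ent D i" for i
    by (simp only: ent_def)
  moreover have "ent (pr (E 0) D) 0 = E 0" by (simp add: ent_def)
  ultimately have "\<forall>i<Suc n. ent (pr (E 0) D) i = E i"
    using D by (metis less_Suc_eq_0_disj)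
  then show ?case by blast
qed simp

section \<open>Decidability of derivations\<close>

lemma rec_ent [rec_intros]:
  assumes "computable_in A f" "computable_in A g"
  shows "computable_in A (\<lambda>v. ent (f v) (g v))"
  unfolding ent_def by (intro rec_intros assms)

lemma rec_run [rec_intros]:
  assumes "computable_in A f" "computable_in A g" "computable_in A h"
  shows "computable_in A (\<lambda>v. run (f v) (g v) (h v))"
  unfolding run_def by (intro rec_intros assms)

lemma rec_isc [rec_intros]: "computable_in A f \<Longrightarrow> computable_in A (\<lambda>v. isc (f v))"
  unfolding isc_def by (intro rec_intros)

lemma dec_mem_image [rec_intros]:
  assumes "computable_in A f" "computable_in A g" "computable_in A h"
  shows "decidable_in A (\<lambda>v. h v \<in> ent (f v) ` {..<g v})"
proof -
  have "decidable_in A (\<lambda>v. \<exists>i<g v. ent (f v) i = h v)"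
    by (intro rec_intros assms rec_comp[OF assms(1)] rec_comp[OF assms(3)])
  moreover have "(\<exists>i<g v. ent (f v) i = h v) \<longleftrightarrow> h v \<in> ent (f v) ` {..<g v}" for v
    unfolding image_iff by (metis lessThan_iff)
  ultimately show ?thesis by simp
qed

text \<open>A witness z can only be the result recorded in some entry, so the unbounded quantifier
  becomes a search over positions.\<close>

lemma dec_ex_run [rec_intros]:
  assumes "computable_in A f" "computable_in A g" "computable_in A a" "computable_in A x"
    and "decidable_in A (\<lambda>w. P (p1 w) (p2 w))"
  shows "decidable_in A (\<lambda>v. \<exists>z. run (a v) (x v) z \<in> ent (f v) ` {..<g v} \<and> P v z)"
proof -
  let ?y = "\<lambda>v j. p2 (p2 (p2 (ent (f v) j)))"
  have f: "computable_in A (\<lambda>w. f (p1 w))" and x: "computable_in A (\<lambda>w. x (p1 w))"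
    and a: "computable_in A (\<lambda>w. a (p1 w))"
    by (rule rec_comp[OF assms(1)] rec_comp[OF assms(3)] rec_comp[OF assms(4)], intro rec_intros)+
  have "decidable_in A (\<lambda>w. P (p1 w) (?y (p1 w) (p2 w)))"
    using dec_comp[OF assms(5), of "\<lambda>w. pr (p1 w) (?y (p1 w) (p2 w))"] f
    by (simp add: rec_pr rec_p1 rec_p2 rec_ent rec_id)
  then have "decidable_in A (\<lambda>v. \<exists>j<g v. ent (f v) j = run (a v) (x v) (?y v j) \<and> P v (?y v j))"
    by (intro rec_intros assms f x a)
  moreover have "(\<exists>j<g v. ent (f v) j = run (a v) (x v) (?y v j) \<and> P v (?y v j)) \<longleftrightarrow>
      (\<exists>z. run (a v) (x v) z \<in> ent (f v) ` {..<g v} \<and> P v z)" (is "?L v \<longleftrightarrow> ?R v") for v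
  proof
    assume "?L v"
    then obtain j where "j < g v" "ent (f v) j = run (a v) (x v) (?y v j)" "P v (?y v j)" by blast
    then show "?R v" by (metis image_eqI lessThan_iff)
  next
    assume "?R v"
    then obtain z j where "j < g v" "run (a v) (x v) z = ent (f v) j" "P v z" by blast
    then show "?L v" by (metis run_isc_simps(5))
  qed
  ultimately show ?thesis by simp
qed

lemma dec_step: "decidable_in A (\<lambda>w. step (ent (p1 (p1 w)) ` {..<p2 (p1 w)}) (p2 w))"
  unfolding step_def code_step_def run_step_def by (intro rec_intros)

text \<open>\<open>p1 D\<close> is the length and \<open>p2 D\<close> the list. No oracle is
  mentioned, which separates the absolutely decidable part of membership in a jump from the truth of
  the answers.\<close>

definition accepts :: "nat \<Rightarrow> nat \<Rightarrow> bool" where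
  "accepts e D \<longleftrightarrow> derivation (p1 D) (ent (p2 D)) \<and>
     (\<exists>y. run e e y \<in> ent (p2 D) ` {..<p1 D})"

lemma dec_accepts [rec_intros]:
  assumes "computable_in A f" "computable_in A g"
  shows "decidable_in A (\<lambda>v. accepts (f v) (g v))"
proof (rule dec_2[OF _ assms])
  have step: "decidable_in A (\<lambda>w. step (ent (p2 (p2 (p1 w))) ` {..<p2 w}) (ent (p2 (p2 (p1 w))) (p2 w)))"
    using dec_comp[OF dec_step, of _ "\<lambda>w. pr (pr (p2 (p2 (p1 w))) (p2 w)) (ent (p2 (p2 (p1 w))) (p2 w))"]
    by (simp add: rec_pr rec_p1 rec_p2 rec_ent rec_id)
  \<comment> \<open>The conjunct \<open>True\<close> gives the existential the shape of
    \<open>dec_ex_run\<close>.\<close>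
  have "decidable_in A (\<lambda>w. (\<forall>i<p1 (p2 w). step (ent (p2 (p2 w)) ` {..<i}) (ent (p2 (p2 w)) i)) \<and>
     (\<exists>y. run (p1 w) (p1 w) y \<in> ent (p2 (p2 w)) ` {..<p1 (p2 w)} \<and> True))"
    by (intro rec_intros step)
  then show "decidable_in A (\<lambda>w. accepts (p1 w) (p2 w))"
    by (simp add: accepts_def derivation_def)
qed

lemma mem_jump_iff_accepts:
  "e \<in> jump A \<longleftrightarrow> (\<exists>D. accepts e D \<and> (\<forall>i<p1 D. query_ok A (ent (p2 D) i)))"
proof
  assume "e \<in> jump A"
  then obtain y n E where E: "derivation n E" "\<forall>i<n. query_ok A (E i)" "run e e y \<in> E ` {..<n}"
    unfolding mem_jump_iff derivable_def by blast
  obtain D where D: "\<forall>i<n. ent D i = E i" using ex_ent by blast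
  have "ent D ` {..<i} = E ` {..<i}" if "i \<le> n" for i
    using D that by (intro image_cong) auto
  with D E have "accepts e (pr n D)" "\<forall>i<n. query_ok A (ent D i)"
    by (auto simp: accepts_def derivation_def)
  then show "\<exists>D. accepts e D \<and> (\<forall>i<p1 D. query_ok A (ent (p2 D) i))"
    by (intro exI[of _ "pr n D"]) simp
next
  assume "\<exists>D. accepts e D \<and> (\<forall>i<p1 D. query_ok A (ent (p2 D) i))"
  then show "e \<in> jump A"
    unfolding mem_jump_iff derivable_def accepts_def by blast
qed

text \<open>Argument and answer become projections of t, leaving a Boolean condition. Negative and
  positive membership in A stand apart because for a c.e. set they have different quantifier
  forms.\<close>

lemma query_ok_iff:
  "query_ok A t \<longleftrightarrow> (t = run (pr 4 0) (p1 (p2 (p2 t))) (p2 (p2 (p2 t))) \<longrightarrow>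
     p2 (p2 (p2 t)) = 0 \<and> p1 (p2 (p2 t)) \<notin> A \<or> p2 (p2 (p2 t)) = 1 \<and> p1 (p2 (p2 t)) \<in> A)"
  unfolding query_ok_def
proof (intro iffI impI allI)
  fix x y
  assume *: "t = run (pr 4 0) (p1 (p2 (p2 t))) (p2 (p2 (p2 t))) \<longrightarrow>
     p2 (p2 (p2 t)) = 0 \<and> p1 (p2 (p2 t)) \<notin> A \<or> p2 (p2 (p2 t)) = 1 \<and> p1 (p2 (p2 t)) \<in> A"
  assume t: "t = run (pr 4 0) x y"
  then show "y = (if x \<in> A then 1 else 0)"
    using *[unfolded t run_isc_simps] by auto
next
  assume "\<forall>x y. t = run (pr 4 0) x y \<longrightarrow> y = (if x \<in> A then 1 else 0)"
    and "t = run (pr 4 0) (p1 (p2 (p2 t))) (p2 (p2 (p2 t)))"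
  then show "p2 (p2 (p2 t)) = 0 \<and> p1 (p2 (p2 t)) \<notin> A \<or> p2 (p2 (p2 t)) = 1 \<and> p1 (p2 (p2 t)) \<in> A"
    by (metis (full_types))
qed

text \<open>For the empty oracle the truth of the answers is decidable as well, so only the search
  for a derivation stays unbounded.\<close>

lemma jump_empty_decidable:
  obtains T where "\<And>A. decidable_in A (\<lambda>w. T (p1 w) (p2 w))" "\<And>e. e \<in> jump {} \<longleftrightarrow> (\<exists>D. T e D)"
proof
  let ?T = "\<lambda>e D. accepts e D \<and> (\<forall>i<p1 D. query_ok {} (ent (p2 D) i))"
  show "decidable_in A (\<lambda>w. ?T (p1 w) (p2 w))" for A
    unfolding query_ok_iff empty_iff by (intro rec_intros)
  show "e \<in> jump {} \<longleftrightarrow> (\<exists>D. ?T e D)" for e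
    by (rule mem_jump_iff_accepts)
qed

text \<open>The sum of chosen witnesses bounds each of them. This collects the stages of finitely
  many oracle answers or refutations.\<close>

lemma ex_uniform_bound:
  fixes P :: "nat \<Rightarrow> nat \<Rightarrow> bool"
  assumes "\<And>i. i < n \<Longrightarrow> \<exists>c. P i c"
  shows "\<exists>b. \<forall>i<n. \<exists>c<b. P i c"
proof -
  obtain f where f: "\<And>i. i < n \<Longrightarrow> P i (f i)" using assms by metis
  have "f i < Suc (sum f {..<n})" if "i < n" for i
    using that by (simp add: less_Suc_eq_le member_le_sum)
  with f show ?thesis by blast
qed

text \<open>The witness \<open>u\<close> is a derivation together with a bound for the enumeration stages of its
  positively answered queries; the negative answers give the universal quantifier.\<close>

lemma jump_of_ce_Sigma2:
  assumes T: "decidable_in B (\<lambda>w. T (p1 w) (p2 w))" "\<And>e. e \<in> A \<longleftrightarrow> (\<exists>D. T e D)"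
  obtains Q where "decidable_in B (\<lambda>w. Q (p1 w) (p1 (p2 w)) (p2 (p2 w)))"
    "\<And>e. e \<in> jump A \<longleftrightarrow> (\<exists>u. \<forall>d. Q e u d)"
proof
  let ?x = "\<lambda>u i. p1 (p2 (p2 (ent (p2 (p1 u)) i)))" and ?y = "\<lambda>u i. p2 (p2 (p2 (ent (p2 (p1 u)) i)))"
  let ?Q = "\<lambda>e u d. accepts e (p1 u) \<and>
     (\<forall>i<p1 (p1 u). ent (p2 (p1 u)) i = run (pr 4 0) (?x u i) (?y u i) \<longrightarrow>
        ?y u i = 0 \<and> \<not> T (?x u i) d \<or> ?y u i = 1 \<and> (\<exists>c<p2 u. T (?x u i) c))"
  show "decidable_in B (\<lambda>w. ?Q (p1 w) (p1 (p2 w)) (p2 (p2 w)))"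
    by (intro rec_intros dec_2[OF T(1)])
  show "e \<in> jump A \<longleftrightarrow> (\<exists>u. \<forall>d. ?Q e u d)" for e
  proof
    assume "e \<in> jump A"
    then obtain D where D: "accepts e D" "\<forall>i<p1 D. query_ok A (ent (p2 D) i)"
      unfolding mem_jump_iff_accepts by blast
    let ?z = "\<lambda>i. p1 (p2 (p2 (ent (p2 D) i)))"
    obtain b where b: "\<forall>i<p1 D. \<exists>c<b. ?z i \<in> A \<longrightarrow> T (?z i) c"
      using ex_uniform_bound[of "p1 D" "\<lambda>i c. ?z i \<in> A \<longrightarrow> T (?z i) c"] T(2) by blast
    have "?Q e (pr D b) d" for d
      using D b T(2) unfolding query_ok_iff pr_simps by meson
    then show "\<exists>u. \<forall>d. ?Q e u d" by blast
  next
    assume "\<exists>u. \<forall>d. ?Q e u d"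
    then obtain u where u: "\<And>d. ?Q e u d" by blast
    \<comment> \<open>Which disjunct applies depends on \<open>?y u i\<close> alone and not on d, so
      the quantifier over d passes inside.\<close>
    have "query_ok A (ent (p2 (p1 u)) i)" if "i < p1 (p1 u)" for i
      unfolding query_ok_iff T(2) using u that by blast
    with u show "e \<in> jump A" unfolding mem_jump_iff_accepts by blast
  qed
qed

text \<open>\<open>R e\<close> holds of the pairs \<open>(n, t)\<close> where \<open>t\<close> is the least stage by which every \<open>u < n\<close> has been
  refuted; there is exactly one such \<open>t\<close> unless some \<open>u < n\<close> is never refuted.\<close>

lemma Sigma2_imp_finite:
  assumes "decidable_in B (\<lambda>w. Q (p1 w) (p1 (p2 w)) (p2 (p2 w)))"
  obtains R where "decidable_in B (\<lambda>w. R (p1 w) (p2 w))"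
    "\<And>e. (\<exists>u. \<forall>d. Q e u d) \<longleftrightarrow> finite {s. R e s}"
proof
  let ?ok = "\<lambda>e n t. \<forall>u<n. \<exists>d<t. \<not> Q e u d"
  let ?R = "\<lambda>e s. ?ok e (p1 s) (p2 s) \<and> (\<forall>t<p2 s. \<not> ?ok e (p1 s) t)"
  have Q: "decidable_in B (\<lambda>v. Q (f v) (g v) (h v))"
    if "computable_in B f" "computable_in B g" "computable_in B h" for f g h
    using dec_comp[OF assms rec_pr[OF that(1) rec_pr[OF that(2,3)]]] by simp
  show "decidable_in B (\<lambda>w. ?R (p1 w) (p2 w))"
    by (intro rec_intros Q)
  show "(\<exists>u. \<forall>d. Q e u d) \<longleftrightarrow> finite {s. ?R e s}" for e
  proof -
    let ?W = "{n. \<exists>t. ?ok e n t}"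
    have "n \<in> p1 ` {s. ?R e s}" if "n \<in> ?W" for n
    proof -
      from that obtain t where "?ok e n t" "\<forall>t'<t. \<not> ?ok e n t'"
        using exists_least_iff[of "?ok e n"] by auto
      then have "?R e (pr n t)" by simp
      then show ?thesis by (intro image_eqI[of _ _ "pr n t"]) auto
    qed
    then have image: "p1 ` {s. ?R e s} = ?W" by blast
    have inj: "inj_on p1 {s. ?R e s}"
    proof (rule inj_onI)
      fix s s' assume "s \<in> {s. ?R e s}" "s' \<in> {s. ?R e s}" and eq: "p1 s = p1 s'"
      then have "?R e s" "?R e s'" by blast+
      then have "\<not> p2 s < p2 s'" "\<not> p2 s' < p2 s" using eq by metis+
      then show "s = s'" using eq by (metis linorder_neqE_nat pr_simps(3))
    qed
    then have "finite {s. ?R e s} \<longleftrightarrow> finite ?W"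
      by (simp only: image[symmetric] finite_image_iff[OF inj])
    also have "\<dots> \<longleftrightarrow> (\<exists>u. \<forall>d. Q e u d)"
    proof
      assume "finite ?W"
      then have "?W \<noteq> UNIV" by auto
      \<comment> \<open>This n has no stage at all. If every u had a refuting d, those for u < n
        would have a common bound, which would be a stage for n.\<close>
      then obtain n where n: "\<And>t. \<not> ?ok e n t" by blast
      show "\<exists>u. \<forall>d. Q e u d"
      proof (rule ccontr)
        assume "\<not> (\<exists>u. \<forall>d. Q e u d)"
        then show False
          using n ex_uniform_bound[of n "\<lambda>u d. \<not> Q e u d"] by blast
      qed
    next
      assume "\<exists>u. \<forall>d. Q e u d"
      then obtain u where u: "\<forall>d. Q e u d" ..
      have "?W \<subseteq> {..u}"
      proof
        fix n assume "n \<in> ?W"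
        with u have "\<not> u < n" by blast
        then show "n \<in> {..u}" by simp
      qed
      then show "finite ?W" by (rule finite_subset) simp
    qed
    finally show ?thesis by simp
  qed
qed

text \<open>The hardness half of the Sigma_2-completeness of finiteness: the first jump is c.e., so
  the second has an exists-forall form, which reduces to finiteness uniformly in e.\<close>

lemma double_jump_iff_finite:
  obtains R where "decidable_in {} (\<lambda>w. R (p1 w) (p2 w))"
    "\<And>e. e \<in> jump (jump {}) \<longleftrightarrow> finite {s. R e s}"
proof (rule jump_empty_decidable)
  fix T assume T: "\<And>A. decidable_in A (\<lambda>w. T (p1 w) (p2 w))" "\<And>e. e \<in> jump {} \<longleftrightarrow> (\<exists>D. T e D)"
  show thesis
  proof (rule jump_of_ce_Sigma2[OF T])
    fix Q assume Q: "decidable_in {} (\<lambda>w. Q (p1 w) (p1 (p2 w)) (p2 (p2 w)))"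
      "\<And>e. e \<in> jump (jump {}) \<longleftrightarrow> (\<exists>u. \<forall>d. Q e u d)"
    show thesis
      by (rule Sigma2_imp_finite[OF Q(1)], rule that) (simp_all add: Q(2))
  qed
qed

section \<open>Computability of parity, halving and integer codes\<close>

lemma dec_even [rec_intros]: "computable_in A f \<Longrightarrow> decidable_in A (\<lambda>v. even (f v))"
proof -
  assume f: "computable_in A f"
  have "decidable_in A (\<lambda>v. rec_nat 0 (\<lambda>_ y. 1 - y) (f v) = (0::nat))"
    by (intro rec_intros f)
  moreover have "rec_nat 0 (\<lambda>_ y. 1 - y) n = n mod 2" for n :: nat
    by (induction n) (auto simp: mod_Suc)
  ultimately show ?thesis by (simp add: even_iff_mod_2_eq_zero)
qed

lemma rec_half [rec_intros]: "computable_in A f \<Longrightarrow> computable_in A (\<lambda>v. f v div 2)"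
proof -
  assume f: "computable_in A f"
  have "computable_in A (\<lambda>v. rec_nat 0 (\<lambda>k y. if even k then y else Suc y) (f v))"
    by (intro rec_intros f)
  moreover have "rec_nat 0 (\<lambda>k y. if even k then y else Suc y) n = n div 2" for n :: nat
    by (induction n) auto
  ultimately show ?thesis by simp
qed

lemma int_decode_cases: "int_decode i = (if even i then int (i div 2) else - int (i div 2) - 1)"
  by (simp add: int_decode_def sum_decode_def)

lemma int_encode_cases: "int_encode j = (if 0 \<le> j then 2 * nat j else Suc (2 * nat (- j - 1)))"
  by (simp add: int_encode_def sum_encode_def)

text \<open>Even codes are the nonnegative integers and odd codes the negative ones, so the code
  moves by two, except that -1, with code 1, crosses over to 0.\<close>

lemma rec_int_succ [rec_intros]:
  assumes "computable_in A f"
  shows "computable_in A (\<lambda>v. int_encode (int_decode (f v) + 1))"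
proof -
  have "int_encode (int_decode i + 1) = (if even i then i + 2 else if i = 1 then 0 else i - 2)" for i
    unfolding int_decode_cases int_encode_cases by (auto elim!: oddE evenE)
  moreover have "computable_in A (\<lambda>v. if even (f v) then f v + 2 else if f v = 1 then 0 else f v - 2)"
    by (intro rec_intros assms)
  ultimately show ?thesis by simp
qed

lemma rec_int_pred [rec_intros]:
  assumes "computable_in A f"
  shows "computable_in A (\<lambda>v. int_encode (int_decode (f v) - 1))"
proof -
  have "int_encode (int_decode i - 1) = (if even i then if i = 0 then 1 else i - 2 else i + 2)" for i
    unfolding int_decode_cases int_encode_cases by (auto elim!: oddE evenE)
  moreover have "computable_in A (\<lambda>v. if even (f v) then if f v = 0 then 1 else f v - 2 else f v + 2)"
    by (intro rec_intros assms)
  ultimately show ?thesis by simp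
qed

lemma rec_transpose [rec_intros]:
  "computable_in A f \<Longrightarrow> computable_in A (\<lambda>v. Transposition.transpose a b (f v))"
  unfolding transpose_def by (intro rec_intros)

section \<open>Cycle types and conjugacy of involutions\<close>

lemma orbit_involution:
  assumes "\<And>x. p (p x) = x"
  shows "orbit p x = {x, p x}"
proof (intro equalityI subsetI)
  fix y assume "y \<in> orbit p x"
  then show "y \<in> {x, p x}" by induction (auto simp: assms)
next
  fix y assume "y \<in> {x, p x}"
  then show "y \<in> orbit p x" by (metis assms insertE orbit.intros singletonD)
qed

lemma bij_involution: "(\<And>x. p (p x) = x) \<Longrightarrow> bij p"
  by (rule o_bij[of p p]) auto

lemma cycles_involution:
  assumes "\<And>x. p (p x) = x"
  shows "cycles_of_length 1 p = (\<lambda>x. {x}) ` {x. p x = x}"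
    and "cycles_of_length 2 p = (\<lambda>x. {x, p x}) ` {x. p x \<noteq> x}"
proof -
  have card: "card {x, p x} = 1 \<longleftrightarrow> p x = x" "card {x, p x} = 2 \<longleftrightarrow> p x \<noteq> x" for x
    by (cases "p x = x"; force)+
  show "cycles_of_length 1 p = (\<lambda>x. {x}) ` {x. p x = x}"
    unfolding cycles_of_length_def orbit_involution[of p, OF assms] card
    by (simp only: setcompr_eq_image) (intro image_cong; simp)
  show "cycles_of_length 2 p = (\<lambda>x. {x, p x}) ` {x. p x \<noteq> x}"
    unfolding cycles_of_length_def orbit_involution[of p, OF assms] card
    by (simp only: setcompr_eq_image)
qed

lemma finite_cycles_involution:
  assumes "\<And>x. p (p x) = x"
  shows "finite (cycles_of_length 1 p) \<longleftrightarrow> finite {x. p x = x}"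
    and "finite (cycles_of_length 2 p) \<longleftrightarrow> finite {x. p x \<noteq> x}"
proof -
  show "finite (cycles_of_length 1 p) \<longleftrightarrow> finite {x. p x = x}"
    unfolding cycles_involution[of p, OF assms] by (rule finite_image_iff) simp
  show "finite (cycles_of_length 2 p) \<longleftrightarrow> finite {x. p x \<noteq> x}"
  proof
    assume "finite (cycles_of_length 2 p)"
    \<comment> \<open>The map from x to its 2-cycle identifies x with \<open>p x\<close>, so
      finiteness is pulled back through the union of the cycles.\<close>
    then have "finite (\<Union> (cycles_of_length 2 p))"
      unfolding cycles_involution[of p, OF assms] by auto
    then show "finite {x. p x \<noteq> x}"
      by (rule rev_finite_subset) (auto simp: cycles_involution[of p, OF assms])
  qed (simp add: cycles_involution[of p, OF assms])
qed

lemma one_inf_involution: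
  assumes "\<And>x. p (p x) = x" "infinite {x. p x = x}"
  shows "one_inf_two_inf p \<longleftrightarrow> infinite {x. p x \<noteq> x}"
    and "one_inf_two_fin p \<longleftrightarrow> finite {x. p x \<noteq> x}"
proof -
  have "card (orbit p x) \<in> {1, 2}" for x
    unfolding orbit_involution[of p, OF assms(1)] by (simp add: card_insert_if)
  then show "one_inf_two_inf p \<longleftrightarrow> infinite {x. p x \<noteq> x}"
    and "one_inf_two_fin p \<longleftrightarrow> finite {x. p x \<noteq> x}"
    unfolding one_inf_two_inf_def one_inf_two_fin_def
    using finite_cycles_involution[of p, OF assms(1)] assms bij_involution[of p] by auto
qed

text \<open>The inverse of \<open>enumerate S\<close>, in rank form because counting below x is
  computable for decidable S.\<close>

lemma bij_betw_count_below:
  fixes S :: "nat set"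
  assumes "infinite S"
  shows "bij_betw (\<lambda>x. card {y. y < x \<and> y \<in> S}) S UNIV"
proof (rule bij_betw_byWitness[where f' = "enumerate S"])
  have count: "card {y. y < enumerate S n \<and> y \<in> S} = n" for n
  proof -
    have "{y. y < enumerate S n \<and> y \<in> S} = enumerate S ` {..<n}"
    proof (intro equalityI subsetI)
      fix y assume y: "y \<in> {y. y < enumerate S n \<and> y \<in> S}"
      then obtain m where "y = enumerate S m" using enumerate_Ex assms by (metis mem_Collect_eq)
      with y show "y \<in> enumerate S ` {..<n}" using assms by auto
    qed (use assms in \<open>auto simp: enumerate_in_set\<close>)
    then show ?thesis
      using inj_enumerate[OF assms] by (simp add: card_image inj_on_subset)
  qed
  then show "\<forall>n\<in>UNIV. card {y. y < enumerate S n \<and> y \<in> S} = n" by simp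
  show "\<forall>x\<in>S. enumerate S (card {y. y < x \<and> y \<in> S}) = x"
    using count assms by (metis enumerate_Ex)
  show "enumerate S ` UNIV \<subseteq> S"
    using assms by (auto simp: enumerate_in_set)
qed auto

text \<open>The 2-cycles are indexed by a and the fixed points by pairs (a, b - 2), so the n-th of
  either kind is explicit.\<close>

definition std_involution :: "nat \<Rightarrow> nat" where
  "std_involution x = pr (p1 x) (Transposition.transpose 0 1 (p2 x))"

lemma std_involution_pr [simp]:
  "std_involution (pr a b) = pr a (Transposition.transpose 0 1 b)"
  by (simp add: std_involution_def)

lemma std_involution_involution [simp]: "std_involution (std_involution x) = x"
  by (simp add: std_involution_def)

lemma computable_std_involution: "computable std_involution"
  unfolding std_involution_def by (intro rec_intros)

lemma one_inf_two_inf_std_involution: "one_inf_two_inf std_involution"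
proof -
  have "infinite (range (\<lambda>n. pr n 2))" "infinite (range (\<lambda>n. pr n 0))"
    by (simp_all add: finite_image_iff inj_on_def)
  moreover have "range (\<lambda>n. pr n 2) \<subseteq> {x. std_involution x = x}"
    "range (\<lambda>n. pr n 0) \<subseteq> {x. std_involution x \<noteq> x}"
    by (auto simp: transpose_def)
  ultimately have "infinite {x. std_involution x = x}" "infinite {x. std_involution x \<noteq> x}"
    using infinite_super by blast+
  then show ?thesis by (simp add: one_inf_involution)
qed

text \<open>The \<open>n\<close>-th fixed point and the \<open>n\<close>-th 2-cycle of \<open>p\<close> are sent to the \<open>n\<close>-th ones of the
  standard involution; this is computable by counting, since having a fixed point at \<open>x\<close> is decidable.\<close>

lemma computable_conjugator:
  assumes comp: "computable p" and inv: "\<And>x. p (p x) = x"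
    and "infinite {x. p x = x}" "infinite {x. p x \<noteq> x}"
  obtains f where "bij f" "computable f" "f \<circ> p = std_involution \<circ> f"
proof
  define F where "F = {x. p x = x}"
  \<comment> \<open>The smaller point represents its 2-cycle. It goes to column 0 and its partner to
    column 1; the rank of a fixed point is read as a pair and moved past these two columns.\<close>
  define L where "L = {x. x < p x}"
  define c where "c S x = card {y. y < x \<and> y \<in> S}" for S :: "nat set" and x
  define f where "f x = (if p x = x then pr (p1 (c F x)) (p2 (c F x) + 2)
    else if x < p x then pr (c L x) 0 else pr (c L (p x)) 1)" for x
  have "{x. p x \<noteq> x} \<subseteq> L \<union> p ` L"
    using inv by (auto simp: L_def image_iff) (metis linorder_neqE_nat)
  then have "infinite L" using assms(4) by (meson finite_UnI finite_imageI finite_subset)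
  moreover have "infinite F" using assms(3) by (simp add: F_def)
  ultimately have L: "bij_betw (c L) L UNIV" and F: "bij_betw (c F) F UNIV"
    unfolding c_def by - (rule bij_betw_count_below, assumption)+
  have "decidable_in {} (\<lambda>x. x \<in> F)" "decidable_in {} (\<lambda>x. x \<in> L)"
    unfolding F_def L_def mem_Collect_eq by (intro rec_intros comp)+
  note dec = dec_comp[OF this(1)] dec_comp[OF this(2)]
  show "computable f"
    unfolding f_def c_def by (intro rec_intros comp dec rec_comp[OF comp])
  have L_imp: "p x \<in> L" if "p x \<noteq> x" "\<not> x < p x" for x
    using that inv by (simp add: L_def)
  show "f \<circ> p = std_involution \<circ> f"
    by (rule ext) (auto simp: f_def inv)
  show "bij f"
  proof (rule bijI)
    show "inj f"
    proof (rule injI)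
      fix x y assume eq: "f x = f y"
      \<comment> \<open>The second component of the value, at least 2, equal to 0 or equal to 1,
        tells the three classes apart.\<close>
      consider "x \<in> F" "y \<in> F" | "x \<in> L" "y \<in> L" | "p x \<in> L" "p y \<in> L" "x \<notin> F" "y \<notin> F" "x \<notin> L" "y \<notin> L"
        using eq inv by (auto simp: f_def F_def L_def split: if_splits)
      then show "x = y"
      proof cases
        case 1
        with eq have "c F x = c F y" by (auto simp: f_def F_def) (metis pr_simps(3))
        with 1 F show ?thesis by (auto simp: bij_betw_def inj_on_def)
      next
        case 2
        with eq have "c L x = c L y" by (auto simp: f_def L_def)
        with 2 L show ?thesis by (auto simp: bij_betw_def inj_on_def)
      next
        case 3
        with eq have "c L (p x) = c L (p y)" by (auto simp: f_def L_def F_def)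
        with 3 L have "p x = p y" by (auto simp: bij_betw_def inj_on_def)
        then show ?thesis using inv by metis
      qed
    qed
    show "surj f"
      unfolding surj_def
    proof
      fix z
      obtain a b where z: "z = pr a b" by (metis pr_simps(3))
      consider "b = 0" | "b = 1" | n where "b = n + 2"
        by (metis One_nat_def add_2_eq_Suc' not0_implies_Suc)
      then show "\<exists>x. z = f x"
      proof cases
        case 1
        obtain x where "x \<in> L" "c L x = a" using L by (auto simp: bij_betw_def) (metis UNIV_I imageE)
        then show ?thesis using 1 z by (intro exI[of _ x]) (auto simp: f_def L_def)
      next
        case 2
        obtain x where "x \<in> L" "c L x = a" using L by (auto simp: bij_betw_def) (metis UNIV_I imageE)
        then show ?thesis using 2 z by (intro exI[of _ "p x"]) (auto simp: f_def L_def inv)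
      next
        case 3
        obtain x where "x \<in> F" "c F x = pr a n" using F by (auto simp: bij_betw_def) (metis UNIV_I imageE)
        then show ?thesis using 3 z by (intro exI[of _ x]) (auto simp: f_def F_def)
      qed
    qed
  qed
qed

section \<open>A finitely generated group containing a uniformly decidable family\<close>

text \<open>
  \<open>pt j s b\<close> is the point \<open>(s, b)\<close> in row \<open>j\<close> of a copy of \<open>\<int> \<times> \<nat> \<times> \<nat>\<close>. Conjugating \<open>flip_rows R\<close> by a
  power of \<open>shift\<close> brings the row \<open>R k\<close> to row 0, and the commutator with \<open>swap_sides\<close>, which only moves
  row 0, erases all other rows.
\<close>

definition pt :: "int \<Rightarrow> nat \<Rightarrow> nat \<Rightarrow> nat" where
  "pt j s b = pr (int_encode j) (pr s b)"

lemma pt_simps [simp]: "int_decode (p1 (pt j s b)) = j" "p1 (p2 (pt j s b)) = s" "p2 (p2 (pt j s b)) = b"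
  "pt j s b = pt j' s' b' \<longleftrightarrow> j = j' \<and> s = s' \<and> b = b'"
  by (auto simp: pt_def int_encode_eq)

lemma pt_cases: obtains j s b where "x = pt j s b"
proof
  show "x = pt (int_decode (p1 x)) (p1 (p2 x)) (p2 (p2 x))" by (simp add: pt_def)
qed

definition shift :: "nat \<Rightarrow> nat" where
  "shift x = pr (int_encode (int_decode (p1 x) + 1)) (p2 x)"

text \<open>Rows are indexed by integers so that the shift is a permutation. Its inverse is a
  generator of its own, so negative powers involve only multiplication in G.\<close>

definition unshift :: "nat \<Rightarrow> nat" where
  "unshift x = pr (int_encode (int_decode (p1 x) - 1)) (p2 x)"

definition flip_rows :: "(nat \<Rightarrow> nat \<Rightarrow> bool) \<Rightarrow> nat \<Rightarrow> nat" where
  "flip_rows R x = (if 0 \<le> int_decode (p1 x) \<and> R (nat (int_decode (p1 x))) (p1 (p2 x))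
     then pr (p1 x) (pr (p1 (p2 x)) (Transposition.transpose 0 1 (p2 (p2 x)))) else x)"

definition swap_sides :: "nat \<Rightarrow> nat" where
  "swap_sides x = (if p1 x = 0
     then pr (p1 x) (pr (p1 (p2 x)) (Transposition.transpose 0 2 (Transposition.transpose 1 3 (p2 (p2 x))))) else x)"

definition row_perm :: "(nat \<Rightarrow> nat \<Rightarrow> bool) \<Rightarrow> nat \<Rightarrow> nat \<Rightarrow> nat" where
  "row_perm R k x = (if p1 x = 0 \<and> R k (p1 (p2 x))
     then pr (p1 x) (pr (p1 (p2 x)) (Transposition.transpose 0 1 (Transposition.transpose 2 3 (p2 (p2 x))))) else x)"

lemma int_encode_eq_0 [simp]: "int_encode j = 0 \<longleftrightarrow> j = 0"
  by (auto simp: int_encode_cases)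

lemma shift_pt [simp]: "shift (pt j s b) = pt (j + 1) s b"
  by (simp add: shift_def pt_def)

lemma unshift_pt [simp]: "unshift (pt j s b) = pt (j - 1) s b"
  by (simp add: unshift_def pt_def)

lemma flip_rows_pt [simp]:
  "flip_rows R (pt j s b) = (if 0 \<le> j \<and> R (nat j) s then pt j s (Transposition.transpose 0 1 b) else pt j s b)"
  by (simp add: flip_rows_def pt_def)

lemma swap_sides_pt [simp]:
  "swap_sides (pt j s b) =
     (if j = 0 then pt j s (Transposition.transpose 0 2 (Transposition.transpose 1 3 b)) else pt j s b)"
  by (simp add: swap_sides_def pt_def)

lemma row_perm_pt [simp]:
  "row_perm R k (pt j s b) = (if j = 0 \<and> R k s
     then pt j s (Transposition.transpose 0 1 (Transposition.transpose 2 3 b)) else pt j s b)"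
  by (simp add: row_perm_def pt_def)

lemma shift_funpow_pt [simp]: "(shift ^^ k) (pt j s b) = pt (j + int k) s b"
  by (induction k) (auto simp: algebra_simps)

lemma unshift_funpow_pt [simp]: "(unshift ^^ k) (pt j s b) = pt (j - int k) s b"
  by (induction k) (auto simp: algebra_simps)

lemma unshift_shift [simp]: "unshift (shift x) = x" "shift (unshift x) = x"
  by (rule pt_cases[of x]; simp)+

lemma bij_shift: "bij shift" "bij unshift"
  by (rule o_bij[of unshift shift] o_bij[of shift unshift]; auto)+

lemma flip_rows_involution [simp]: "flip_rows R (flip_rows R x) = x"
  by (rule pt_cases[of x]) simp

lemma swap_sides_involution [simp]: "swap_sides (swap_sides x) = x"
  by (rule pt_cases[of x]) (simp add: transpose_def)

lemma row_perm_involution [simp]: "row_perm R k (row_perm R k x) = x"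
  by (rule pt_cases[of x]) (simp add: transpose_def)

text \<open>Both \<open>q\<close> and \<open>swap_sides\<close> are involutions, so the word is
  their commutator. Off row 0 the two copies of \<open>q\<close> cancel. In row 0, at s with
  \<open>R k s\<close>, \<open>q\<close> swaps columns 0 and 1 and its conjugate swaps columns 2 and
  3.\<close>

lemma row_perm_eq_word:
  fixes R k
  defines "q \<equiv> (unshift ^^ k) \<circ> flip_rows R \<circ> (shift ^^ k)"
  shows "row_perm R k = (q \<circ> swap_sides) \<circ> (q \<circ> swap_sides)"
proof
  show "row_perm R k x = ((q \<circ> swap_sides) \<circ> (q \<circ> swap_sides)) x" for x
    by (rule pt_cases[of x]) (auto simp: q_def transpose_def)
qed

lemma computable_shift: "computable shift" "computable unshift"
  unfolding shift_def unshift_def by (intro rec_intros)+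

lemma computable_flip_rows:
  assumes "decidable_in {} (\<lambda>w. R (p1 w) (p2 w))"
  shows "computable (flip_rows R)"
proof -
  have "0 \<le> int_decode i \<and> R (nat (int_decode i)) s \<longleftrightarrow> even i \<and> R (i div 2) s" for i s
    by (auto simp: int_decode_cases)
  then show ?thesis
    unfolding flip_rows_def by (simp only:) (intro rec_intros dec_2[OF assms])
qed

lemma computable_swap_sides: "computable swap_sides"
  unfolding swap_sides_def by (intro rec_intros)

lemma infinite_fixed_row_perm: "infinite {x. row_perm R k x = x}"
proof
  assume "finite {x. row_perm R k x = x}"
  \<comment> \<open>Column 4 is the first that no row permutation touches.\<close>
  moreover have "range (\<lambda>n. pt 0 n 4) \<subseteq> {x. row_perm R k x = x}" by (auto simp: transpose_def)
  ultimately have "finite (range (\<lambda>n. pt 0 n 4))" by (rule rev_finite_subset)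
  then show False by (simp add: finite_image_iff inj_on_def)
qed

text \<open>Each element of \<open>R k\<close> contributes four moved points, that is, two
  2-cycles.\<close>

lemma finite_moved_row_perm: "finite {x. row_perm R k x \<noteq> x} \<longleftrightarrow> finite {s. R k s}"
proof -
  have "{x. row_perm R k x \<noteq> x} = (\<lambda>(s, b). pt 0 s b) ` ({s. R k s} \<times> {..<4})" (is "?M = _ ` ?S")
  proof (intro equalityI subsetI)
    fix x assume "x \<in> ?M"
    then show "x \<in> (\<lambda>(s, b). pt 0 s b) ` ?S"
      by (cases x rule: pt_cases) (auto simp: transpose_def image_iff split: if_splits)
  next
    fix x assume "x \<in> (\<lambda>(s, b). pt 0 s b) ` ?S"
    then obtain s b where "x = pt 0 s b" "R k s" "b < 4" by auto
    moreover from this have "b = 0 \<or> b = 1 \<or> b = 2 \<or> b = 3" by auto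
    ultimately show "x \<in> ?M" by (auto simp: transpose_def)
  qed
  moreover have "inj_on (\<lambda>(s, b). pt 0 s b) ?S" by (auto simp: inj_on_def)
  ultimately have "finite ?M \<longleftrightarrow> finite ?S" by (simp only: finite_image_iff)
  also have "\<dots> \<longleftrightarrow> finite {s. R k s}"
    by (auto simp: finite_cartesian_product_iff lessThan_empty_iff)
  finally show ?thesis .
qed

section \<open>Deciding the double jump from the group\<close>

lemma carrier_computable_sym: "p \<in> carrier computable_sym \<longleftrightarrow> bij p \<and> computable p"
  by (simp add: computable_sym_def)

lemma comp_in_computable_sym:
  "p \<in> carrier computable_sym \<Longrightarrow> q \<in> carrier computable_sym \<Longrightarrow> p \<circ> q \<in> carrier computable_sym"
  unfolding carrier_computable_sym using bij_comp[of q p] rec_comp[of _ p q] by (simp add: comp_def)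

lemma id_in_computable_sym: "id \<in> carrier computable_sym"
  unfolding carrier_computable_sym by (simp add: rec_id[folded id_def])

lemma funpow_in_computable_sym:
  "p \<in> carrier computable_sym \<Longrightarrow> p ^^ k \<in> carrier computable_sym"
  by (induction k) (auto intro: comp_in_computable_sym id_in_computable_sym)

text \<open>The junk value off the carrier is chosen so that the program for the multiplication, which may
  diverge there, is only ever run on elements of the carrier.\<close>

definition total_mult :: "(nat, 'b) monoid_scheme \<Rightarrow> nat \<Rightarrow> nat \<Rightarrow> nat" where
  "total_mult G a b =
     (if a \<in> carrier G \<and> b \<in> carrier G then a \<otimes>\<^bsub>G\<^esub> b else \<one>\<^bsub>G\<^esub> \<otimes>\<^bsub>G\<^esub> \<one>\<^bsub>G\<^esub>)"

lemma dec_carrier: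
  "computable_group X G \<Longrightarrow> computable_in X f \<Longrightarrow> decidable_in X (\<lambda>v. f v \<in> carrier G)"
  unfolding computable_group_def set_computable_in_def decidable_in_def[symmetric]
  by (blast intro: dec_comp[of X "\<lambda>x. x \<in> carrier G"])

lemma rec_total_mult:
  assumes G: "computable_group X G" and "computable_in X f" "computable_in X g"
  shows "computable_in X (\<lambda>v. total_mult G (f v) (g v))"
proof (rule rec_2[OF _ assms(2,3)])
  let ?s = "\<lambda>w. if p1 w \<in> carrier G \<and> p2 w \<in> carrier G then w else pr \<one>\<^bsub>G\<^esub> \<one>\<^bsub>G\<^esub>"
  from G obtain c where c: "\<And>a b. a \<in> carrier G \<Longrightarrow> b \<in> carrier G \<Longrightarrow> phi X c (pr a b) = Some (a \<otimes>\<^bsub>G\<^esub> b)"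
    unfolding computable_group_def pr_def by blast
  have one: "\<one>\<^bsub>G\<^esub> \<in> carrier G"
    using G by (simp add: computable_group_def group.is_monoid monoid.one_closed)
  have "computable_in X ?s" by (intro rec_intros dec_carrier[OF G])
  then obtain d where d: "\<And>w. phi X d w = Some (?s w)" unfolding computable_in_def by blast
  have "phi X c w = Some (p1 w \<otimes>\<^bsub>G\<^esub> p2 w)" if "p1 w \<in> carrier G" "p2 w \<in> carrier G" for w
    using c[OF that] by simp
  then have "phi X (CComp c d) w = Some (total_mult G (p1 w) (p2 w))" for w
    using c[OF one one] by (auto simp: d total_mult_def)
  then show "computable_in X (\<lambda>w. total_mult G (p1 w) (p2 w))" by (rule computable_inI)
qed

theorem theorem3p2:
  fixes X :: "nat set"
    and G :: "(nat, 'b) monoid_scheme"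
    and H :: "(nat \<Rightarrow> nat) \<Rightarrow> nat"
  assumes "computable_group X G"
    and "H \<in> mon computable_sym G"
    and "\<And>p q. p \<in> carrier computable_sym \<Longrightarrow> one_inf_two_inf p \<Longrightarrow>
           q \<in> carrier computable_sym \<Longrightarrow> one_inf_two_fin q \<Longrightarrow>
           \<not> conjugate_in G (H p) (H q)"
  shows "deg (jump (jump {})) \<le> deg X"
proof (rule double_jump_iff_finite)
  fix R assume decR: "decidable_in {} (\<lambda>w. R (p1 w) (p2 w))"
    and R: "\<And>e. e \<in> jump (jump {}) \<longleftrightarrow> finite {s. R e s}"
  interpret group G using assms(1) by (simp add: computable_group_def)
  let ?C = "carrier computable_sym"
  have H_closed: "H p \<in> carrier G" if "p \<in> ?C" for p
    using assms(2) that by (auto simp: mon_def hom_def)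
  have H_comp: "H (p \<circ> q) = H p \<otimes>\<^bsub>G\<^esub> H q" if "p \<in> ?C" "q \<in> ?C" for p q
    using assms(2) that by (auto simp: mon_def hom_def computable_sym_def)

  text \<open>Truncating \<open>R e\<close> below \<open>n\<close> changes nothing for some \<open>n\<close> iff \<open>R e\<close> is finite, so finiteness becomes an
    equality between members of the family.\<close>
  define R' where "R' k s \<longleftrightarrow> R (p1 k) s \<and> (p2 k = 0 \<or> s < p2 k)" for k s
  have decR': "decidable_in {} (\<lambda>w. R' (p1 w) (p2 w))"
    unfolding R'_def by (intro rec_intros dec_2[OF decR])
  define P where "P e n = row_perm R' (pr e n)" for e n
  define h where "h e n = H (P e n)" for e n
  have gens: "shift \<in> ?C" "unshift \<in> ?C" "swap_sides \<in> ?C" "flip_rows R' \<in> ?C"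
    unfolding carrier_computable_sym
    by (auto simp: bij_shift computable_shift computable_swap_sides
        intro: computable_flip_rows decR' bij_involution)
  note C_intros = comp_in_computable_sym funpow_in_computable_sym gens id_in_computable_sym
  have P_C: "P e n \<in> ?C" for e n
    unfolding P_def row_perm_eq_word by (intro C_intros)
  have r_C: "std_involution \<in> ?C"
    unfolding carrier_computable_sym by (simp add: bij_involution computable_std_involution)

  have rec_h: "computable_in X (\<lambda>v. h (f v) (g v))"
    if fg: "computable_in X f" "computable_in X g" for f g
  proof -
    \<comment> \<open>\<open>H\<close> enters only through constants: its values at
      \<open>id\<close> and at the four generators. The exponent is the sole varying input.\<close>
    let ?pow = "\<lambda>p k. rec_nat (H id) (\<lambda>_ y. total_mult G (H p) y) k"
    have mult: "H (p \<circ> q) = total_mult G (H p) (H q)" if "p \<in> ?C" "q \<in> ?C" for p q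
      using that by (simp add: total_mult_def H_closed H_comp)
    have pow: "H (p ^^ k) = ?pow p k" if "p \<in> ?C" for p k
    proof (induction k)
      case (Suc k)
      then show ?case
        using that by (simp only: funpow.simps mult funpow_in_computable_sym old.nat.rec)
    qed simp
    let ?q = "\<lambda>k. total_mult G (total_mult G (total_mult G (?pow unshift k) (H (flip_rows R')))
      (?pow shift k)) (H swap_sides)"
    have "h e n = total_mult G (?q (pr e n)) (?q (pr e n))" for e n
      unfolding h_def P_def row_perm_eq_word
      by (simp only: mult C_intros pow[symmetric])
    moreover have "computable_in X (\<lambda>v. total_mult G (?q (pr (f v) (g v))) (?q (pr (f v) (g v))))"
      by (intro rec_intros rec_total_mult[OF assms(1)] fg)
    ultimately show ?thesis by simp
  qed

  have fin: "one_inf_two_fin (P e n) \<longleftrightarrow> finite {s. R e s} \<or> n \<noteq> 0" for e n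
  proof -
    have "one_inf_two_fin (P e n) \<longleftrightarrow> finite {s. R' (pr e n) s}"
      unfolding P_def by (simp add: one_inf_involution infinite_fixed_row_perm finite_moved_row_perm)
    also have "\<dots> \<longleftrightarrow> finite {s. R e s} \<or> n \<noteq> 0"
      by (cases "n = 0") (auto simp: R'_def)
    finally show ?thesis .
  qed

  \<comment> \<open>Bound 0 stands for no truncation, so the genuine truncations have index
    \<open>Suc n\<close>.\<close>
  define found where "found e n \<longleftrightarrow> h e 0 = h e (Suc n)" for e n
  \<comment> \<open>Conjugacy written without an inverse, so that only multiplication has to be
    computed.\<close>
  define conjugates where "conjugates e g \<longleftrightarrow> g \<in> carrier G \<and> total_mult G g (h e 0) = total_mult G (H std_involution) g" for e g
  have found: "\<exists>n. found e n" if "finite {s. R e s}" for e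
  proof -
    from that obtain n where "\<forall>s\<in>{s. R e s}. s < n" using finite_nat_set_iff_bounded by blast
    then have "R' (pr e 0) s = R' (pr e (Suc n)) s" for s
      unfolding R'_def by auto
    then have "P e 0 = P e (Suc n)" unfolding P_def row_perm_def by presburger
    then show ?thesis by (auto simp: found_def h_def)
  qed
  have not_found: "\<not> found e n" if "infinite {s. R e s}" for e n
  proof
    assume "found e n"
    then have "P e 0 = P e (Suc n)"
      using assms(2) P_C unfolding found_def h_def mon_def by (auto dest: inj_onD)
    \<comment> \<open>A truncation has finitely many 2-cycles, while the untruncated involution of
      an infinite set does not.\<close>
    then show False using fin[of e 0] fin[of e "Suc n"] that by simp
  qed
  have conjugates: "\<exists>g. conjugates e g" if "infinite {s. R e s}" for e
  proof -
    have "infinite {x. P e 0 x \<noteq> x}"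
      using that unfolding P_def by (simp add: finite_moved_row_perm R'_def)
    then obtain f where f: "bij f" "computable f" "f \<circ> P e 0 = std_involution \<circ> f"
      using computable_conjugator[of "P e 0"] P_C[of e 0] infinite_fixed_row_perm[of R' "pr e 0"]
      unfolding P_def carrier_computable_sym by auto
    then have "f \<in> ?C" by (simp add: carrier_computable_sym)
    then have "H f \<otimes>\<^bsub>G\<^esub> h e 0 = H std_involution \<otimes>\<^bsub>G\<^esub> H f"
      using f(3) P_C r_C unfolding h_def by (metis H_comp)
    then have "conjugates e (H f)"
      using \<open>f \<in> ?C\<close> P_C r_C by (simp add: conjugates_def total_mult_def h_def H_closed)
    then show ?thesis ..
  qed
  have not_conjugates: "\<not> conjugates e g" if "finite {s. R e s}" for e g
  proof
    assume "conjugates e g"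
    then have g: "g \<in> carrier G" "g \<otimes>\<^bsub>G\<^esub> h e 0 = H std_involution \<otimes>\<^bsub>G\<^esub> g"
      using P_C r_C by (auto simp: conjugates_def total_mult_def h_def H_closed)
    have closed: "h e 0 \<in> carrier G" "H std_involution \<in> carrier G"
      using P_C r_C by (simp_all add: h_def H_closed)
    \<comment> \<open>The hypothesis starts from the 1_inf 2_inf side, so the conjugating element is
      the inverse of g.\<close>
    have "h e 0 = inv\<^bsub>G\<^esub> g \<otimes>\<^bsub>G\<^esub> H std_involution \<otimes>\<^bsub>G\<^esub> inv\<^bsub>G\<^esub> (inv\<^bsub>G\<^esub> g)"
      using g closed by (metis inv_closed inv_inv inv_solve_left m_assoc m_closed)
    with g have "conjugate_in G (H std_involution) (h e 0)"
      unfolding conjugate_in_def by blast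
    with assms(3)[OF r_C one_inf_two_inf_std_involution P_C] fin that show False
      unfolding h_def by blast
  qed

  \<comment> \<open>Each n is tried both as a truncation index and as a group element. For a given e
    only one kind of success can ever occur, so the kind found decides membership.\<close>
  define search where "search e = (LEAST n. found e n \<or> conjugates e n)" for e
  have ex: "\<exists>n. found e n \<or> conjugates e n" for e
    using found conjugates by blast
  have "e \<in> jump (jump {}) \<longleftrightarrow> found e (search e)" for e
    using LeastI_ex[OF ex[of e]] not_conjugates not_found R unfolding search_def by blast
  moreover have "decidable_in X (\<lambda>w. found (p1 w) (p2 w) \<or> conjugates (p1 w) (p2 w))"
    unfolding found_def conjugates_def
    by (intro rec_intros rec_h rec_total_mult[OF assms(1)] dec_carrier[OF assms(1)])
  then have "computable_in X search"
    unfolding search_def using ex by (rule rec_Least)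
  then have "decidable_in X (\<lambda>e. found e (search e))"
    unfolding found_def by (intro rec_intros rec_h)
  ultimately show ?thesis
    unfolding deg_le_iff set_computable_in_def decidable_in_def by simp
qed

end
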